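(* Let $L=\mathbb{Z}\alpha$ with $\langle\alpha,\alpha\rangle=-2k$, $k\in\mathbb{Z}_{>0}$. For every $m\in\mathbb{Z}_{>0}$, $V_L^+(m)\subseteq C_2(V_L^+)$.
   Context: Let $L$ be an even lattice, $\mathfrak{h}=\mathbb{C}\otimes_{\mathbb{Z}}L$, $M(1)$ the Heisenberg vertex algebra on $\mathfrak{h}$, and $V_L=M(1)\otimes\mathbb{C}[L]$ the lattice vertex algebra with conformal vector $\omega=\frac12\sum_ih_i(-1)^2\mathbf{1}$. Let $\theta$ be the automorphism of $V_L$ given by $\theta(\beta_1(-n_1)\cdots\beta_r(-n_r)e^\beta)=(-1)^r\beta_1(-n_1)\cdots\beta_r(-n_r)e^{-\beta}$, $V_L^+$ its fixed-point vertex subalgebra, and $M(1)^\pm$ the $\pm1$-eigenspaces of $\theta$ on $M(1)$. For $L=\mathbb{Z}\alpha$ and $m>0$: $E^m=e^{m\alpha}+e^{-m\alpha}$, $F^m=e^{m\alpha}-e^{-m\alpha}$, $V_L^+(m)=M(1)^+\otimes E^m\oplus M(1)^-\otimes F^m$ (so $V_L^+=M(1)^+\oplus\bigoplus_{m\ge1}V_L^+(m)$). $C_2(V)=\mathrm{Span}_{\mathbb{C}}\{u_{-2}v\mid u,v\in V\}$, where $Y(u,z)=\sum_nu_nz^{-n-1}$. *)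

theory Defs
  imports Complex_Main "HOL-Library.Multiset" "HOL-Library.Groups_Big_Fun"
    "HOL-Library.Function_Algebras"
begin

text \<open>
  Rank one lattice L = Z alpha with (alpha,alpha) = -2k.
  A vector of V_L = M(1) (x) C[L] is a finitely supported function on the
  basis {alpha(-n_1)...alpha(-n_r) e^{m alpha}}, indexed by the multiset
  {n_1,...,n_r} of positive integers and m :: int.  Since (alpha,alpha) is
  even, the trivial 2-cocycle is admissible, i.e. e_beta e^gamma = e^(beta+gamma).
\<close>

type_synonym vec = "nat multiset \<times> int \<Rightarrow> complex"
type_synonym ser = "int \<Rightarrow> vec"            \<comment> \<open>coefficient of z^p\<close>
type_synonym opser = "int \<Rightarrow> vec \<Rightarrow> vec"   \<comment> \<open>operator coefficient of z^p\<close>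

definition ip :: "nat \<Rightarrow> int" where "ip k = - 2 * int k"

definition VL :: "vec set" where
  "VL = {f. finite {x. f x \<noteq> 0} \<and> (\<forall>\<mu> m. f (\<mu>, m) \<noteq> 0 \<longrightarrow> 0 \<notin># \<mu>)}"

definition sc :: "complex \<Rightarrow> vec \<Rightarrow> vec" where
  "sc c f = (\<lambda>x. c * f x)"

definition heis :: "nat \<Rightarrow> int \<Rightarrow> vec \<Rightarrow> vec" where
  "heis k n f = (\<lambda>(\<mu>, m).
     if n < 0 then (if nat (-n) \<in># \<mu> then f (\<mu> - {#nat (-n)#}, m) else 0)
     else if n = 0 then of_int (ip k * m) * f (\<mu>, m)
     else of_int n * of_int (ip k) * of_nat (count \<mu> (nat n) + 1) * f (\<mu> + {#nat n#}, m))"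

fun hprod :: "nat \<Rightarrow> int list \<Rightarrow> vec \<Rightarrow> vec" where
  "hprod k [] f = f"
| "hprod k (n # ns) f = heis k n (hprod k ns f)"

definition elat :: "int \<Rightarrow> vec \<Rightarrow> vec" where
  "elat j f = (\<lambda>(\<mu>, m). f (\<mu>, m - j))"

definition zb :: "nat \<Rightarrow> int \<Rightarrow> vec \<Rightarrow> ser" where
  "zb k j v p = (\<lambda>(\<mu>, m). if ip k * j * m = p then v (\<mu>, m) else 0)"

definition app :: "opser \<Rightarrow> ser \<Rightarrow> ser" where
  "app A F p = (\<Sum>q. A q (F (p - q)))"

fun app_list :: "opser list \<Rightarrow> ser \<Rightarrow> ser" where
  "app_list [] F = F"
| "app_list (A # As) F = app A (app_list As F)"

definition parts :: "nat \<Rightarrow> nat multiset set" where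
  "parts q = {\<nu>. 0 \<notin># \<nu> \<and> sum_mset \<nu> = q}"

text \<open>E^-(-j alpha, z) = exp (sum_{n>0} j alpha(-n) z^n / n)\<close>
definition Em :: "nat \<Rightarrow> int \<Rightarrow> opser" where
  "Em k j q x = (if q < 0 then 0 else
     (\<Sum>\<nu>\<in>parts (nat q).
        sc (\<Prod>n\<in>set_mset \<nu>. (of_int j / of_nat n) ^ count \<nu> n / fact (count \<nu> n))
           (hprod k (map (\<lambda>n. - int n) (sorted_list_of_multiset \<nu>)) x)))"

text \<open>E^+(-j alpha, z) = exp (- sum_{n>0} j alpha(n) z^(-n) / n)\<close>
definition Ep :: "nat \<Rightarrow> int \<Rightarrow> opser" where
  "Ep k j q x = (if q > 0 then 0 else
     (\<Sum>\<nu>\<in>parts (nat (-q)).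
        sc (\<Prod>n\<in>set_mset \<nu>. (- of_int j / of_nat n) ^ count \<nu> n / fact (count \<nu> n))
           (hprod k (map int (sorted_list_of_multiset \<nu>)) x)))"

text \<open>creation part of (1/(p-1)!) (d/dz)^(p-1) alpha(z): sum_{q>0} C(q-1,p-1) alpha(-q) z^(q-p)\<close>
definition cre :: "nat \<Rightarrow> nat \<Rightarrow> opser" where
  "cre k p d x = (if d + int p \<ge> 1
     then sc (of_nat (nat (d + int p - 1) choose (p - 1))) (heis k (- (d + int p)) x) else 0)"

text \<open>annihilation part: sum_{n\<ge>0} C(-n-1,p-1) alpha(n) z^(-n-p)\<close>
definition ann :: "nat \<Rightarrow> nat \<Rightarrow> opser" where
  "ann k p d x = (if - d - int p \<ge> 0
     then sc ((-1) ^ (p - 1) * of_nat (nat (- d - 1) choose (p - 1))) (heis k (- d - int p) x) else 0)"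

definition shift :: "int \<Rightarrow> ser \<Rightarrow> ser" where
  "shift j F p = elat j (F p)"

text \<open>Y(alpha(-p_1)...alpha(-p_r) e^{j alpha}, z) v, given by the normal ordered product
  :(d^(p_1-1) alpha(z)) ... (d^(p_r-1) alpha(z)) Y(e^{j alpha}, z):, where
  Y(e^beta,z) = E^-(-beta,z) E^+(-beta,z) e_beta z^beta; normal ordering puts
  alpha(n) (n<0) and e_beta to the left of alpha(n) (n>=0) and z^beta.
  Splitting each factor into creation / annihilation part; kappa = creation indices.\<close>
definition Ybasis :: "nat \<Rightarrow> nat multiset \<times> int \<Rightarrow> vec \<Rightarrow> ser" where
  "Ybasis k u v = (case u of (lam, j) \<Rightarrow>
     (\<lambda>p. \<Sum>\<kappa>\<in>{\<kappa>. \<kappa> \<subseteq># lam}.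
        sc (\<Prod>n\<in>set_mset lam. of_nat (count lam n choose count \<kappa> n))
         ((app_list (map (cre k) (sorted_list_of_multiset \<kappa>))
           (app (Em k j)
             (shift j
               (app_list (map (ann k) (sorted_list_of_multiset (lam - \<kappa>)))
                 (app (Ep k j) (zb k j v)))))) p)))"

definition Y :: "nat \<Rightarrow> vec \<Rightarrow> vec \<Rightarrow> ser" where
  "Y k u v p = (\<Sum>x\<in>{x. u x \<noteq> 0}. sc (u x) (Ybasis k x v p))"

definition mode :: "nat \<Rightarrow> vec \<Rightarrow> int \<Rightarrow> vec \<Rightarrow> vec" where
  "mode k u n v = Y k u v (- n - 1)"

definition theta :: "vec \<Rightarrow> vec" where
  "theta f = (\<lambda>(\<mu>, m). (-1) ^ size \<mu> * f (\<mu>, - m))"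

definition VLplus :: "vec set" where
  "VLplus = {f \<in> VL. theta f = f}"

definition M1 :: "vec set" where
  "M1 = {f \<in> VL. \<forall>\<mu> m. m \<noteq> 0 \<longrightarrow> f (\<mu>, m) = 0}"

definition M1plus :: "vec set" where
  "M1plus = {f \<in> M1. theta f = f}"

definition M1minus :: "vec set" where
  "M1minus = {f \<in> M1. theta f = - f}"

definition tens :: "vec \<Rightarrow> int \<Rightarrow> vec" where
  "tens p j = (\<lambda>(\<mu>, i). if i = j then p (\<mu>, 0) else 0)"

definition VLplus_m :: "int \<Rightarrow> vec set" where
  "VLplus_m m = {(tens p m + tens p (- m)) + (tens q m - tens q (- m)) | p q.
                  p \<in> M1plus \<and> q \<in> M1minus}"

inductive_set C2 :: "nat \<Rightarrow> vec set \<Rightarrow> vec set" for k :: nat and V :: "vec set" where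
  C2_zero: "0 \<in> C2 k V"
| C2_gen: "u \<in> V \<Longrightarrow> v \<in> V \<Longrightarrow> mode k u (-2) v \<in> C2 k V"
| C2_add: "a \<in> C2 k V \<Longrightarrow> b \<in> C2 k V \<Longrightarrow> a + b \<in> C2 k V"
| C2_smult: "a \<in> C2 k V \<Longrightarrow> sc c a \<in> C2 k V"

end

theory Submission
  imports Defs
begin

text \<open>
  Let \<open>W\<close> be the space of vectors whose symmetrisation \<open>f + \<theta> f\<close> lies in \<open>C\<^sub>2(V\<^sub>L\<^sup>+)\<close>; the claim is
  \<open>M(1) \<otimes> e\<^bsup>m\<alpha>\<^esup> \<subseteq> W\<close>.  Write \<open>h\<^sub>n = \<alpha>(-n)\<close>.  Two families of relations modulo \<open>W\<close> come from the
  translation operator, \<open>m h\<^sub>1 p \<equiv> - \<partial>p\<close>, and from the (-2)-products with \<open>h\<^sub>a h\<^sub>b 1\<close>, whose leading term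
  is \<open>b h\<^sub>a h\<^bsub>b+1\<^esub> + a h\<^bsub>a+1\<^esub> h\<^sub>b\<close>.  Together they reduce every monomial of degree \<open>N \<ge> 1\<close> to a multiple
  of \<open>h\<^sub>N e\<^bsup>m\<alpha>\<^esup>\<close>.  In degree \<open>N \<ge> 5\<close> the relations are overdetermined, and since the lattice is negative
  definite the resulting coefficient of \<open>h\<^sub>N\<close> is nonzero, so all of degree at least 5 lies in \<open>W\<close>.
  For low degree \<open>r\<close> take \<open>i = m + j\<close> and the (-2)-product of \<open>h\<^sub>p e\<^bsup>i\<alpha>\<^esup>\<close> with \<open>E\<^sup>j\<close>, where
  \<open>p = r - 1 + 2kij\<close>: its component in \<open>e\<^bsup>(i+j)\<alpha>\<^esup>\<close> has degree \<open>r + 4kij \<ge> 5\<close>, while the one in \<open>e\<^bsup>m\<alpha>\<^esup>\<close> is a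
  nonzero multiple of the degree \<open>r\<close> part of \<open>exp (i \<Sum> h\<^sub>n z\<^sup>n / n)\<close>.  That part is a polynomial in \<open>i\<close>
  with linear coefficient \<open>h\<^sub>r / r\<close> and lies in \<open>W\<close> for all \<open>i > m\<close>, which forces \<open>h\<^sub>r e\<^bsup>m\<alpha>\<^esup> \<in> W\<close>.
\<close>

text \<open>The basis vector \<open>\<alpha>(-n1)...\<alpha>(-nr) e^(m \<alpha>)\<close> with
  \<open>\<nu>\<close> consisting of \<open>n1,...,nr\<close>.\<close>

definition mon :: "nat multiset \<Rightarrow> int \<Rightarrow> vec" where
  "mon \<nu> m = (\<lambda>x. if x = (\<nu>, m) then 1 else 0)"

lemma mon_apply: "mon \<nu> m x = (if x = (\<nu>, m) then 1 else 0)"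
  by (simp add: mon_def)

lemmas fun_apply = plus_fun_apply zero_fun_apply

text \<open>As default simplification rules these two rewrite eta-expanded vectors pointwise.\<close>
declare fun_apply [simp del]

section \<open>Linearity\<close>

lemma sc_simps [simp]:
  "sc c 0 = 0" "sc 0 f = 0" "sc 1 f = f" "sc c (sc d f) = sc (c * d) f"
  by (auto simp: sc_def fun_eq_iff fun_apply)

lemma sc_add_right: "sc c (f + g) = sc c f + sc c g"
  by (auto simp: sc_def fun_eq_iff fun_apply algebra_simps)

lemma sc_add_left: "sc (c + d) f = sc c f + sc d f"
  by (auto simp: sc_def fun_eq_iff fun_apply algebra_simps)

lemma sc_diff_right: "sc c (f - g) = sc c f - sc c g"
  by (auto simp: sc_def fun_eq_iff algebra_simps)

lemma sc_minus_one: "sc (-1) f = - f"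
  by (auto simp: sc_def fun_eq_iff fun_apply)

lemma sc_eq_0_iff: "sc c f = 0 \<longleftrightarrow> c = 0 \<or> f = 0"
  by (auto simp: sc_def fun_eq_iff fun_apply)

lemma sc_sum: "sc c (\<Sum>x\<in>A. f x) = (\<Sum>x\<in>A. sc c (f x))"
  by (induction A rule: infinite_finite_induct) (simp_all add: sc_add_right)

lemma sum_apply: "(\<Sum>x\<in>A. f x) y = (\<Sum>x\<in>A. f x y)"
  by (induction A rule: infinite_finite_induct) (simp_all add: fun_apply)

lemma heis_0 [simp]: "heis k n 0 = 0"
  by (auto simp: heis_def fun_eq_iff fun_apply)

lemma heis_sc: "heis k n (sc c f) = sc c (heis k n f)"
  by (auto simp: heis_def sc_def fun_eq_iff fun_apply)

lemma heis_add: "heis k n (f + g) = heis k n f + heis k n g"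
  by (auto simp: heis_def fun_eq_iff fun_apply algebra_simps)

lemma heis_sum: "heis k n (\<Sum>x\<in>A. f x) = (\<Sum>x\<in>A. heis k n (f x))"
  by (induction A rule: infinite_finite_induct) (simp_all add: heis_add)

lemma hprod_0 [simp]: "hprod k ns 0 = 0"
  by (induction ns) simp_all

lemma hprod_sc: "hprod k ns (sc c f) = sc c (hprod k ns f)"
  by (induction ns) (simp_all add: heis_sc)

lemma elat_0 [simp]: "elat j 0 = 0"
  by (auto simp: elat_def fun_eq_iff fun_apply)

lemma elat_sc: "elat j (sc c f) = sc c (elat j f)"
  by (auto simp: elat_def sc_def fun_eq_iff fun_apply)

lemma Em_0 [simp]: "Em k j q 0 = 0"
  by (simp add: Em_def)

lemma Em_sc: "Em k j q (sc c x) = sc c (Em k j q x)"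
  by (simp add: Em_def hprod_sc sc_sum mult.commute)

lemma Ep_0 [simp]: "Ep k j q 0 = 0"
  by (simp add: Ep_def)

lemma Ep_sc: "Ep k j q (sc c x) = sc c (Ep k j q x)"
  by (simp add: Ep_def hprod_sc sc_sum mult.commute)

lemma cre_0 [simp]: "cre k p d 0 = 0"
  by (simp add: cre_def)

lemma cre_sc: "cre k p d (sc c x) = sc c (cre k p d x)"
  by (simp add: cre_def heis_sc mult.commute)

lemma ann_0 [simp]: "ann k p d 0 = 0"
  by (simp add: ann_def)

lemma ann_sc: "ann k p d (sc c x) = sc c (ann k p d x)"
  by (simp add: ann_def heis_sc mult.commute)

lemma theta_0 [simp]: "theta 0 = 0"
  by (auto simp: theta_def fun_eq_iff fun_apply)

lemma theta_sc: "theta (sc c f) = sc c (theta f)"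
  by (auto simp: theta_def sc_def fun_eq_iff fun_apply)

lemma theta_add: "theta (f + g) = theta f + theta g"
  by (auto simp: theta_def fun_eq_iff fun_apply algebra_simps)

lemma theta_sum: "theta (\<Sum>x\<in>A. f x) = (\<Sum>x\<in>A. theta (f x))"
  by (induction A rule: infinite_finite_induct) (simp_all add: theta_add)

lemma theta_theta [simp]: "theta (theta f) = f"
proof
  fix x
  show "theta (theta f) x = f x"
    by (cases x; cases "even (size (fst x))") (auto simp: theta_def)
qed

lemma theta_eq_0_iff [simp]: "theta f = 0 \<longleftrightarrow> f = 0"
  by (metis theta_0 theta_theta)

text \<open>A \<open>Sum_any\<close> over an infinite support is 0, so additivity alone does not
  suffice. \<open>theta\<close> and, below, \<open>sc c\<close> with nonzero \<open>c\<close> are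
  injective and hence preserve the support.\<close>

lemma theta_Sum_any: "theta (Sum_any f) = (Sum_any (\<lambda>q::int. theta (f q)))"
  by (simp add: Sum_any.expand_set theta_sum)

lemma sc_Sum_any: "c \<noteq> 0 \<Longrightarrow> sc c (Sum_any f) = (Sum_any (\<lambda>q::int. sc c (f q)))"
  by (simp add: Sum_any.expand_set sc_sum sc_eq_0_iff)

section \<open>Equivariance of the vertex operators under theta\<close>

text \<open>For \<open>n \<noteq> 0\<close> the number of oscillators changes by one; for
  \<open>n = 0\<close> the eigenvalue \<open>ip k * m\<close> changes sign with
  \<open>m\<close>.\<close>

lemma theta_heis: "theta (heis k n f) = sc (-1) (heis k n (theta f))"
proof -
  have "size \<mu> = Suc (size (\<mu> - {#x#}))" if "x \<in># \<mu>" for x and \<mu> :: "nat multiset"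
    using that by (metis insert_DiffM size_add_mset)
  then show ?thesis
    by (auto simp: theta_def heis_def sc_def fun_eq_iff)
qed

lemma theta_hprod: "theta (hprod k ns f) = sc ((-1) ^ length ns) (hprod k ns (theta f))"
  by (induction ns) (simp_all add: theta_heis heis_sc)

lemma theta_elat: "theta (elat j f) = elat (-j) (theta f)"
  by (auto simp: theta_def elat_def fun_eq_iff)

lemma theta_zb: "theta (zb k j v p) = zb k (-j) (theta v) p"
  by (auto simp: theta_def zb_def fun_eq_iff)

lemma minus_one_power_size: "(-1::complex) ^ size \<nu> = (\<Prod>n\<in>set_mset \<nu>. (-1) ^ count \<nu> n)"
  by (simp add: size_multiset_overloaded_eq power_sum)

lemma length_sorted_list_of_multiset [simp]: "length (sorted_list_of_multiset \<nu>) = size \<nu>"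
  by (metis mset_sorted_list_of_multiset size_mset)

text \<open>The sign that \<open>theta\<close> produces on a product of \<open>size \<nu>\<close>
  oscillators is absorbed into the exponential coefficients by negating \<open>x\<close>. Hence
  \<open>theta\<close> exchanges the exponential operators for \<open>j\<close> and
  \<open>-j\<close>.\<close>

lemma prod_count_uminus:
  "(-1) ^ size \<nu> * (\<Prod>n\<in>set_mset \<nu>. (x / of_nat n) ^ count \<nu> n / fact (count \<nu> n))
   = (\<Prod>n\<in>set_mset \<nu>. (- x / of_nat n :: complex) ^ count \<nu> n / fact (count \<nu> n))"
  unfolding minus_one_power_size prod.distrib [symmetric]
proof (rule prod.cong [OF refl])
  fix n
  have "(- x / of_nat n) ^ count \<nu> n = (-1) ^ count \<nu> n * (x / of_nat n) ^ count \<nu> n"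
    unfolding power_mult_distrib [symmetric] by simp
  then show "(-1) ^ count \<nu> n * ((x / of_nat n) ^ count \<nu> n / fact (count \<nu> n))
      = (- x / of_nat n) ^ count \<nu> n / fact (count \<nu> n)"
    by simp
qed

lemma theta_Em: "theta (Em k j q x) = Em k (-j) q (theta x)"
  using prod_count_uminus [where x="of_int j"]
  by (simp add: Em_def theta_sum theta_sc theta_hprod mult.commute)

lemma theta_Ep: "theta (Ep k j q x) = Ep k (-j) q (theta x)"
  using prod_count_uminus [where x="- of_int j"]
  by (simp add: Ep_def theta_sum theta_sc theta_hprod mult.commute)

lemma theta_app:
  assumes "\<And>q x. theta (A q x) = sc s (B q (theta x))" "\<And>p. theta (F p) = sc t (G p)"
    and "\<And>q c x. B q (sc c x) = sc c (B q x)" "s \<noteq> 0" "t \<noteq> 0"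
  shows "theta (app A F p) = sc (s * t) (app B G p)"
  using assms by (simp add: app_def theta_Sum_any sc_Sum_any)

lemma theta_app_list_cre:
  assumes "\<And>p. theta (F p) = sc t (G p)" "t \<noteq> 0"
  shows "theta (app_list (map (cre k) l) F p) = sc ((-1) ^ length l * t) (app_list (map (cre k) l) G p)"
proof (induction l arbitrary: p)
  case (Cons a l)
  have "theta (cre k a q x) = sc (-1) (cre k a q (theta x))" for q x
    by (simp add: cre_def theta_sc theta_heis)
  from theta_app [where s="-1" and A="cre k a", OF this Cons.IH cre_sc] show ?case
    using assms(2) by simp
qed (use assms in auto)

lemma theta_app_list_ann:
  assumes "\<And>p. theta (F p) = G p"
  shows "theta (app_list (map (ann k) l) F p) = sc ((-1) ^ length l) (app_list (map (ann k) l) G p)"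
proof (induction l arbitrary: p)
  case (Cons a l)
  have "theta (ann k a q x) = sc (-1) (ann k a q (theta x))" for q x
    by (simp add: ann_def theta_sc theta_heis)
  from theta_app [where s="-1" and A="ann k a", OF this Cons.IH ann_sc] show ?case
    by simp
qed (use assms in auto)

text \<open>This is \<open>theta (Y(u,z) v) = Y(theta u,z) (theta v)\<close> for a basis vector
  \<open>u\<close>. Every Heisenberg factor contributes one sign, whether it creates or annihilates,
  so the total sign is the same for all \<open>\<kappa>\<close>.\<close>

lemma theta_Ybasis:
  "theta (Ybasis k (lam, j) v p) = sc ((-1) ^ size lam) (Ybasis k (lam, -j) (theta v) p)"
proof -
  have *: "theta ((app_list (map (cre k) (sorted_list_of_multiset \<kappa>)) (app (Em k j)
        (shift j (app_list (map (ann k) (sorted_list_of_multiset (lam - \<kappa>)))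
          (app (Ep k j) (zb k j v)))))) p)
      = sc ((-1) ^ size lam) ((app_list (map (cre k) (sorted_list_of_multiset \<kappa>)) (app (Em k (-j))
        (shift (-j) (app_list (map (ann k) (sorted_list_of_multiset (lam - \<kappa>)))
          (app (Ep k (-j)) (zb k (-j) (theta v))))))) p)"
    (is "theta (app_list ?C (app _ (shift _ (app_list ?A (app ?E ?Z)))) _)
         = sc _ (app_list _ (app _ (shift _ (app_list _ (app ?E' ?Z')))) _)")
    if "\<kappa> \<subseteq># lam" for \<kappa>
  proof -
    let ?s = "(-1) ^ size (lam - \<kappa>)"
    have 1: "theta (app ?E ?Z q) = app ?E' ?Z' q" for q
      using theta_app [where s=1 and t=1, of ?E ?E' ?Z ?Z'] by (simp add: theta_Ep theta_zb Ep_sc)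
    have "theta (app_list ?A (app ?E ?Z) q) = sc ?s (app_list ?A (app ?E' ?Z') q)" for q
      using theta_app_list_ann [OF 1] by simp
    then have "theta (shift j (app_list ?A (app ?E ?Z)) q)
        = sc ?s (shift (-j) (app_list ?A (app ?E' ?Z')) q)" for q
      by (simp add: shift_def theta_elat elat_sc)
    then have "theta (app (Em k j) (shift j (app_list ?A (app ?E ?Z))) q)
        = sc ?s (app (Em k (-j)) (shift (-j) (app_list ?A (app ?E' ?Z'))) q)" for q
      using theta_app [where s=1 and t="?s" and A="Em k j" and B="Em k (-j)"]
      by (simp add: theta_Em Em_sc)
    note theta_app_list_cre [OF this, where p=p and k=k and l="sorted_list_of_multiset \<kappa>"]
    then show ?thesis
      using size_Diff_submset [OF that] size_mset_mono [OF that] by (simp flip: power_add)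
  qed
  show ?thesis
    by (auto simp: Ybasis_def theta_sum theta_sc * sc_sum mult.commute intro!: sum.cong)
qed

section \<open>Action on monomials\<close>

lemma heis_mon_neg:
  assumes "n \<ge> 1"
  shows "heis k (- int n) (mon \<nu> m) = mon (add_mset n \<nu>) m"
  using assms by (auto simp: heis_def mon_def fun_eq_iff)

lemma heis_mon_zero: "heis k 0 (mon \<nu> m) = sc (of_int (ip k * m)) (mon \<nu> m)"
  by (auto simp: heis_def mon_def sc_def fun_eq_iff)

lemma heis_mon_pos:
  assumes "n \<ge> 1"
  shows "heis k (int n) (mon \<nu> m)
    = sc (of_nat n * of_int (ip k) * of_nat (count \<nu> n)) (mon (\<nu> - {#n#}) m)"
proof -
  have "(add_mset n \<mu> = \<nu>) \<longleftrightarrow> (n \<in># \<nu> \<and> \<mu> = \<nu> - {#n#})" for \<mu>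
    by auto
  then show ?thesis
    using assms by (auto simp: heis_def mon_def sc_def fun_eq_iff not_in_iff)
qed

lemma theta_mon: "theta (mon \<nu> m) = sc ((-1) ^ size \<nu>) (mon \<nu> (-m))"
  by (auto simp: theta_def mon_def sc_def fun_eq_iff)

lemma elat_mon: "elat j (mon \<nu> m) = mon \<nu> (m + j)"
  by (auto simp: elat_def mon_def fun_eq_iff)

lemma hprod_mon:
  assumes "0 \<notin> set l"
  shows "hprod k (map (\<lambda>n. - int n) l) (mon \<mu> m) = mon (mset l + \<mu>) m"
  using assms by (induction l) (auto simp: heis_mon_neg Suc_le_eq)

lemma finite_parts: "finite (parts q)"
proof (induction q rule: less_induct)
  case (less q)
  have "parts q \<subseteq> insert {#} (\<Union>x\<in>{1..q}. add_mset x ` parts (q - x))"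
  proof
    fix \<nu> assume \<nu>: "\<nu> \<in> parts q"
    show "\<nu> \<in> insert {#} (\<Union>x\<in>{1..q}. add_mset x ` parts (q - x))"
    proof (cases \<nu>)
      case (add x \<mu>)
      with \<nu> have "x \<in> {1..q}" "\<mu> \<in> parts (q - x)"
        by (auto simp: parts_def)
      then show ?thesis using add by auto
    qed simp
  qed
  moreover have "finite (insert {#} (\<Union>x\<in>{1..q}. add_mset x ` parts (q - x)))"
    using less by auto
  ultimately show ?case
    by (rule finite_subset)
qed

lemma parts_0: "parts 0 = {{#}}"
  by (auto simp: parts_def multiset_eq_iff not_in_iff) (metis count_inI not_gr_zero)

lemma parts_1: "parts 1 = {{#1#}}"
proof -
  have "\<nu> = {#1#}" if "\<nu> \<in> parts 1" for \<nu>
  proof (cases \<nu>)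
    case (add x \<mu>)
    with that have "0 < x" "0 \<notin># \<mu>" "x + sum_mset \<mu> = 1"
      by (auto simp: parts_def)
    then have "x = 1" "\<mu> \<in> parts 0"
      unfolding parts_def mem_Collect_eq by linarith+
    then show ?thesis using add parts_0 by simp
  qed (use that in \<open>simp add: parts_def\<close>)
  then show ?thesis by (auto simp: parts_def)
qed

lemma Em_deg_0: "Em k j 0 x = x"
  by (simp add: Em_def parts_0)

lemma Em_deg_1: "Em k j 1 x = sc (of_int j) (heis k (-1) x)"
  using parts_1 by (simp add: Em_def)

lemma Em_neg: "q < 0 \<Longrightarrow> Em k j q x = 0"
  by (simp add: Em_def)

lemma Ep_deg_0: "Ep k j 0 x = x"
  by (simp add: Ep_def parts_0)

lemma Em_exponent_0: "Em k 0 q x = (if q = 0 then x else 0)"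
proof (cases "q > 0")
  case True
  have "\<nu> \<noteq> {#}" if "\<nu> \<in> parts (nat q)" for \<nu>
    using that True by (auto simp: parts_def)
  then have "sc (\<Prod>n\<in>set_mset \<nu>. (0 / of_nat n) ^ count \<nu> n / fact (count \<nu> n)) y = 0"
    if "\<nu> \<in> parts (nat q)" for \<nu> y
    using that by (auto simp: sc_eq_0_iff prod_zero_iff)
  then show ?thesis
    using True by (simp add: Em_def)
qed (auto simp: Em_deg_0 Em_neg)

lemma Ep_exponent_0: "Ep k 0 q x = (if q = 0 then x else 0)"
proof (cases "q < 0")
  case True
  have "\<nu> \<noteq> {#}" if "\<nu> \<in> parts (nat (-q))" for \<nu>
    using that True by (auto simp: parts_def)
  then have "sc (\<Prod>n\<in>set_mset \<nu>. (0 / of_nat n) ^ count \<nu> n / fact (count \<nu> n)) y = 0"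
    if "\<nu> \<in> parts (nat (-q))" for \<nu> y
    using that by (auto simp: sc_eq_0_iff prod_zero_iff)
  then show ?thesis
    using True by (simp add: Ep_def)
qed (cases "q = 0"; simp add: Ep_deg_0; simp add: Ep_def)

lemma Em_mon:
  "Em k j (int q) (mon {#} m) = (\<Sum>\<nu>\<in>parts q.
     sc (\<Prod>n\<in>set_mset \<nu>. (of_int j / of_nat n) ^ count \<nu> n / fact (count \<nu> n)) (mon \<nu> m))"
proof -
  have "hprod k (map (\<lambda>n. - int n) (sorted_list_of_multiset \<nu>)) (mon {#} m) = mon \<nu> m"
    if "\<nu> \<in> parts q" for \<nu>
    using that by (subst hprod_mon) (auto simp: parts_def)
  then show ?thesis
    by (simp add: Em_def)
qed

text \<open>Every \<open>\<alpha>(n)\<close> with \<open>n > 0\<close> kills a combination of pure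
  exponentials, so only the constant term of the series survives.\<close>

lemma Ep_no_oscillators:
  assumes "\<And>\<mu> m. x (\<mu>, m) \<noteq> 0 \<Longrightarrow> \<mu> = {#}"
  shows "Ep k j q x = (if q = 0 then x else 0)"
proof (cases "q < 0")
  case True
  have heis: "heis k (int n) x = 0" if "n \<noteq> 0" for n
    using that assms by (fastforce simp: heis_def fun_eq_iff fun_apply)
  have hprod: "hprod k (map int l) x = 0" if "l \<noteq> []" "0 \<notin> set l" for l
    using that
  proof (induction l)
    case (Cons n l)
    then show ?case using heis by (cases "l = []") simp_all
  qed simp
  have "hprod k (map int (sorted_list_of_multiset \<nu>)) x = 0" if "\<nu> \<in> parts (nat (-q))" for \<nu>
  proof (rule hprod)
    have "\<nu> \<noteq> {#}"
      using that True by (auto simp: parts_def)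
    then show "sorted_list_of_multiset \<nu> \<noteq> []"
      by (metis mset.simps(1) mset_sorted_list_of_multiset)
  qed (use that in \<open>simp add: parts_def\<close>)
  then show ?thesis
    using True by (simp add: Ep_def)
qed (cases "q = 0"; simp add: Ep_deg_0; simp add: Ep_def)

text \<open>For \<open>-p < d < 0\<close> the binomial coefficient vanishes: a derivative of the
  creation part has no negative powers of \<open>z\<close>.\<close>

lemma cre_neg: "d < 0 \<Longrightarrow> p \<ge> 1 \<Longrightarrow> cre k p d x = 0"
  by (auto simp: cre_def binomial_eq_0)

lemma cre_nonneg:
  "p \<ge> 1 \<Longrightarrow> cre k p (int d) x = sc (of_nat ((d + p - 1) choose (p - 1))) (heis k (- int (d + p)) x)"
  by (auto simp: cre_def nat_diff_distrib nat_add_distrib)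

lemma cre_deg_0: "p \<ge> 1 \<Longrightarrow> cre k p 0 x = heis k (- int p) x"
  using cre_nonneg [of p k 0] by simp

lemma cre_deg_1: "p \<ge> 1 \<Longrightarrow> cre k p 1 x = sc (of_nat p) (heis k (- int (p + 1)) x)"
  using cre_nonneg [of p k 1] by (cases p) (simp_all add: add.commute)

section \<open>Evaluating compositions of operator series\<close>

lemma app_eq_sum:
  assumes "finite S" "\<And>q. q \<notin> S \<Longrightarrow> A q (F (p - q)) = 0"
  shows "app A F p = (\<Sum>q\<in>S. A q (F (p - q)))"
  unfolding app_def using assms by (intro Sum_any.expand_superset) auto

lemma app_eq_single:
  assumes "\<And>q. q \<noteq> r \<Longrightarrow> A q (F (p - q)) = 0"
  shows "app A F p = A r (F (p - r))"
  using app_eq_sum [of "{r}" A F p] assms by auto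

lemma app_eq_0: "(\<And>q. A q (F (p - q)) = 0) \<Longrightarrow> app A F p = 0"
  using app_eq_sum [of "{}" A F p] by auto

lemma app_list_cre_0: "app_list (map (cre k) l) (\<lambda>_. 0) p = 0"
  by (induction l arbitrary: p) (auto intro!: app_eq_0)

lemma app_Em_exponent_0: "app (Em k 0) F = F"
proof
  show "app (Em k 0) F p = F p" for p
    by (subst app_eq_single [where r=0]) (auto simp: Em_exponent_0)
qed

lemma app_Ep_exponent_0: "app (Ep k 0) F = F"
proof
  show "app (Ep k 0) F p = F p" for p
    by (subst app_eq_single [where r=0]) (auto simp: Ep_exponent_0)
qed

lemma app_Ep_no_oscillators:
  assumes "\<And>p \<mu> m. F p (\<mu>, m) \<noteq> 0 \<Longrightarrow> \<mu> = {#}"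
  shows "app (Ep k j) F p = F p"
  using assms by (subst app_eq_single [where r=0]) (auto simp: Ep_no_oscillators)

lemma submultisets_add_mset:
  "{\<kappa>. \<kappa> \<subseteq># add_mset x M} = {\<kappa>. \<kappa> \<subseteq># M} \<union> add_mset x ` {\<kappa>. \<kappa> \<subseteq># M}"
proof (intro equalityI subsetI)
  fix \<kappa> assume "\<kappa> \<in> {\<kappa>. \<kappa> \<subseteq># add_mset x M}"
  then have k: "\<kappa> \<subseteq># add_mset x M" by simp
  show "\<kappa> \<in> {\<kappa>. \<kappa> \<subseteq># M} \<union> add_mset x ` {\<kappa>. \<kappa> \<subseteq># M}"
  proof (cases "x \<in># \<kappa>")
    case True
    then obtain \<kappa>' where "\<kappa> = add_mset x \<kappa>'" by (metis insert_DiffM)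
    with k show ?thesis by auto
  next
    case False
    with k have "\<kappa> \<subseteq># M"
      by (metis diff_single_trivial subset_eq_diff_conv add_mset_add_single)
    then show ?thesis by simp
  qed
qed (auto intro: subset_mset.order_trans)

lemma finite_submultisets: "finite {\<kappa>. \<kappa> \<subseteq># M}"
  by (induction M) (simp_all add: submultisets_add_mset)

section \<open>The symmetrised C2-space\<close>

definition W :: "nat \<Rightarrow> vec set" where
  "W k = {f. f + theta f \<in> C2 k VLplus}"

lemma W_0 [simp]: "0 \<in> W k"
  by (simp add: W_def C2_zero)

lemma W_add: "f \<in> W k \<Longrightarrow> g \<in> W k \<Longrightarrow> f + g \<in> W k"
  unfolding W_def mem_Collect_eq theta_add
  using C2_add [of "f + theta f" k VLplus "g + theta g"] by (simp add: algebra_simps)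

lemma W_sc: "f \<in> W k \<Longrightarrow> sc c f \<in> W k"
  unfolding W_def mem_Collect_eq theta_sc
  using C2_smult [of "f + theta f" k VLplus c] by (simp add: sc_add_right)

lemma W_diff: "f \<in> W k \<Longrightarrow> g \<in> W k \<Longrightarrow> f - g \<in> W k"
  using W_add [of f k "sc (-1) g"] W_sc [of g k "-1"] by (simp add: sc_minus_one)

lemma W_sum: "(\<And>x. x \<in> A \<Longrightarrow> f x \<in> W k) \<Longrightarrow> (\<Sum>x\<in>A. f x) \<in> W k"
  by (induction A rule: infinite_finite_induct) (simp_all add: W_add)

lemma W_sc_cancel: "sc c f \<in> W k \<Longrightarrow> c \<noteq> 0 \<Longrightarrow> f \<in> W k"
  using W_sc [of "sc c f" k "1 / c"] by simp

lemma W_add_cancel: "f + g \<in> W k \<Longrightarrow> g \<in> W k \<Longrightarrow> f \<in> W k"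
  using W_diff [of "f + g" k g] by simp

lemma mon_symm_in_VLplus:
  assumes "0 \<notin># \<nu>"
  shows "mon \<nu> m + theta (mon \<nu> m) \<in> VLplus"
proof -
  let ?f = "mon \<nu> m + theta (mon \<nu> m)"
  have "x \<in> {(\<nu>, m), (\<nu>, -m)}" if "?f x \<noteq> 0" for x
    using that by (auto simp: fun_apply theta_mon mon_apply sc_def split: if_splits)
  then have "{x. ?f x \<noteq> 0} \<subseteq> {(\<nu>, m), (\<nu>, -m)}"
    by blast
  then have "finite {x. ?f x \<noteq> 0}" "\<forall>\<mu> i. ?f (\<mu>, i) \<noteq> 0 \<longrightarrow> 0 \<notin># \<mu>"
    using assms by (auto intro: finite_subset)
  then show ?thesis
    by (simp add: VLplus_def VL_def theta_add add.commute)
qed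

lemma Y_mon: "Y k (mon lam j) v p = Ybasis k (lam, j) v p"
proof -
  have "{x. mon lam j x \<noteq> 0} = {(lam, j)}"
    by (auto simp: mon_def)
  then show ?thesis
    by (simp add: Y_def) (simp add: mon_def)
qed

text \<open>\<open>j \<noteq> 0\<close> keeps the two basis indices distinct, so the sum in
  \<open>Y\<close> has exactly two terms. By \<open>theta_Ybasis\<close> and the invariance of
  \<open>v\<close>, the second is the \<open>theta\<close>-image of the first.\<close>

lemma Y_mon_symm:
  assumes "j \<noteq> 0" "theta v = v"
  shows "Y k (mon lam j + theta (mon lam j)) v p = Ybasis k (lam, j) v p + theta (Ybasis k (lam, j) v p)"
proof -
  let ?u = "mon lam j + theta (mon lam j)"
  have "{x. ?u x \<noteq> 0} = {(lam, j), (lam, -j)}" "?u (lam, j) = 1" "?u (lam, -j) = (-1) ^ size lam"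
    using assms by (auto simp: fun_apply theta_mon mon_apply sc_def split: if_splits)
  then show ?thesis
    using assms by (simp add: Y_def theta_Ybasis)
qed

text \<open>Mode \<open>n\<close> sits at \<open>z^(-n-1)\<close>, so the (-2)-mode is the
  coefficient of \<open>z^1\<close>; hence the argument 1 here and below.\<close>

lemma Ybasis_in_W:
  assumes "0 \<notin># lam" "j \<noteq> 0" "v \<in> VLplus"
  shows "Ybasis k (lam, j) v 1 \<in> W k"
proof -
  have "mode k (mon lam j + theta (mon lam j)) (-2) v \<in> C2 k VLplus"
    using assms by (intro C2_gen mon_symm_in_VLplus)
  moreover have "theta v = v"
    using assms by (simp add: VLplus_def)
  ultimately show ?thesis
    using assms by (simp add: W_def mode_def Y_mon_symm)
qed

text \<open>For even length \<open>mon lam 0\<close> is itself fixed by \<open>theta\<close>, so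
  here the second factor is symmetrised instead. Additivity in that factor is a hypothesis because
  \<open>Sum_any\<close> splits over sums only under finiteness of supports; it is checked later on
  explicit formulas.\<close>

lemma Ybasis_exponent_0_in_W:
  assumes "0 \<notin># lam" "even (size lam)" "0 \<notin># \<nu>"
    and "Ybasis k (lam, 0) (mon \<nu> m + theta (mon \<nu> m)) 1
      = Ybasis k (lam, 0) (mon \<nu> m) 1 + Ybasis k (lam, 0) (theta (mon \<nu> m)) 1"
  shows "Ybasis k (lam, 0) (mon \<nu> m) 1 \<in> W k"
proof -
  have "finite {x. mon lam 0 x \<noteq> 0}"
    by (rule finite_subset [of _ "{(lam, 0)}"]) (auto simp: mon_apply)
  then have "mon lam 0 \<in> VLplus"
    using assms by (auto simp: VLplus_def VL_def theta_mon) (auto simp: mon_apply split: if_splits)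
  then have "mode k (mon lam 0) (-2) (mon \<nu> m + theta (mon \<nu> m)) \<in> C2 k VLplus"
    using assms by (intro C2_gen mon_symm_in_VLplus)
  then show ?thesis
    using assms by (simp add: W_def mode_def Y_mon theta_Ybasis)
qed

section \<open>The translation operator\<close>

lemma sum_mset_heis: "heis k n (\<Sum>x\<in>#M. f x) = (\<Sum>x\<in>#M. heis k n (f x))"
  by (induction M) (simp_all add: heis_add)

text \<open>Leibniz rule to first order: the series \<open>cre k x\<close> starts with
  \<open>\<alpha>(-x) + x \<alpha>(-x-1) z\<close>, so at \<open>z^1\<close> either \<open>F\<close>
  supplies its own linear term or exactly one factor is raised. The vanishing at negative powers is
  carried along to bound the convolutions.\<close>

lemma app_list_cre_deg_le_1:
  assumes "0 \<notin> set l" "\<And>p. p < 0 \<Longrightarrow> F p = 0" "F 0 = mon {#} j" "F 1 = sc c (mon {#1#} j)"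
  shows "(\<forall>p<0. app_list (map (cre k) l) F p = 0) \<and>
    app_list (map (cre k) l) F 0 = mon (mset l) j \<and>
    app_list (map (cre k) l) F 1 = sc c (mon (add_mset 1 (mset l)) j)
      + (\<Sum>x\<in>#mset l. sc (of_nat x) (mon (add_mset (x + 1) (mset l - {#x#})) j))"
  using assms(1)
proof (induction l)
  case Nil
  show ?case using assms by simp
next
  case (Cons a l)
  let ?R = "app_list (map (cre k) l) F"
  have a: "a \<ge> 1" using Cons.prems by (auto simp: Suc_le_eq)
  have R: "\<forall>p<0. ?R p = 0" "?R 0 = mon (mset l) j"
    "?R 1 = sc c (mon (add_mset 1 (mset l)) j)
      + (\<Sum>x\<in>#mset l. sc (of_nat x) (mon (add_mset (x + 1) (mset l - {#x#})) j))"
    using Cons by auto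
  have out: "cre k a q (?R (p - q)) = 0" if "q < 0 \<or> q > p" for p q
    using that a R(1) by (auto simp: cre_neg)
  have neg: "app (cre k a) ?R p = 0" if "p < 0" for p
    using that by (intro app_eq_0 out) linarith
  have "app (cre k a) ?R 0 = cre k a 0 (?R 0)"
    using out [of _ 0] by (subst app_eq_single [where r=0]) (auto simp: neq_iff)
  then have zero: "app (cre k a) ?R 0 = mon (add_mset a (mset l)) j"
    using a by (simp add: R cre_deg_0 heis_mon_neg)
  have "app (cre k a) ?R 1 = (\<Sum>q\<in>{0, 1}. cre k a q (?R (1 - q)))"
  proof (rule app_eq_sum)
    fix q :: int assume "q \<notin> {0, 1}"
    then have "q < 0 \<or> q > 1" by auto
    then show "cre k a q (?R (1 - q)) = 0" by (rule out)
  qed simp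
  also have "\<dots> = heis k (- int a) (?R 1) + sc (of_nat a) (heis k (- int (a + 1)) (?R 0))"
    using a by (simp add: cre_deg_0 cre_deg_1)
  also have "heis k (- int (a + 1)) (?R 0) = mon (add_mset (a + 1) (mset l)) j"
    unfolding R(2) by (rule heis_mon_neg) simp
  also have "heis k (- int a) (?R 1) = sc c (mon (add_mset 1 (add_mset a (mset l))) j)
      + (\<Sum>x\<in>#mset l. sc (of_nat x) (mon (add_mset a (add_mset (x + 1) (mset l - {#x#}))) j))"
    using a by (simp add: R heis_add heis_sc sum_mset_heis heis_mon_neg add_mset_commute)
  also have "(\<Sum>x\<in>#mset l. sc (of_nat x) (mon (add_mset a (add_mset (x + 1) (mset l - {#x#}))) j))
      = (\<Sum>x\<in>#mset l. sc (of_nat x) (mon (add_mset (x + 1) (add_mset a (mset l) - {#x#})) j))"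
  proof (intro arg_cong [where f=sum_mset] image_mset_cong)
    fix x assume "x \<in># mset l"
    then have "add_mset a (add_mset (x + 1) (mset l - {#x#})) = add_mset (x + 1) (add_mset a (mset l) - {#x#})"
      by (metis add_mset_commute add_mset_remove_trivial insert_DiffM)
    then show "sc (of_nat x) (mon (add_mset a (add_mset (x + 1) (mset l - {#x#}))) j)
        = sc (of_nat x) (mon (add_mset (x + 1) (add_mset a (mset l) - {#x#})) j)"
      by (simp only:)
  qed
  finally have one: "app (cre k a) ?R 1 = sc c (mon (add_mset 1 (mset (a # l))) j)
      + (\<Sum>x\<in>#mset (a # l). sc (of_nat x) (mon (add_mset (x + 1) (mset (a # l) - {#x#})) j))"
    by (simp add: add_ac)
  show ?case
    using neg zero one unfolding list.map app_list.simps by simp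
qed

text \<open>Since \<open>Y(u,z) 1 = exp(z L(-1)) u\<close>, the coefficient of \<open>z^1\<close> is
  the translate \<open>L(-1) u\<close>. Annihilation factors, including \<open>\<alpha>(0)\<close>,
  kill the vacuum, which leaves only \<open>\<kappa> = lam\<close>.\<close>

lemma Ybasis_vacuum:
  assumes "0 \<notin># lam"
  shows "Ybasis k (lam, j) (mon {#} 0) 1 = sc (of_int j) (mon (add_mset 1 lam) j)
    + (\<Sum>x\<in>#lam. sc (of_nat x) (mon (add_mset (x + 1) (lam - {#x#})) j))"
proof -
  let ?Z = "\<lambda>p::int. if p = 0 then mon {#} 0 else 0"
  have "zb k j (mon {#} 0) = ?Z"
    by (auto simp: zb_def mon_apply fun_apply fun_eq_iff)
  then have Z: "app (Ep k j) (zb k j (mon {#} 0)) = ?Z"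
    by (intro ext, subst app_Ep_no_oscillators) (auto simp: mon_apply fun_apply split: if_splits)
  have ann: "app_list (map (ann k) l) ?Z = (\<lambda>_. 0)" if "l \<noteq> []" for l
    using that
  proof (induction l)
    case (Cons a l)
    have "ann k a d (app_list (map (ann k) l) ?Z p) = 0" for d p
    proof (cases "l = []")
      case True
      have "heis k n (mon {#} 0) = 0" if "n \<ge> 0" for n
        using that heis_mon_pos [of "nat n" k "{#}" 0] heis_mon_zero [of k "{#}" 0]
        by (cases "n = 0") simp_all
      then show ?thesis using True by (simp add: ann_def)
    qed (use Cons in simp)
    then show ?case by (simp add: app_eq_0 fun_eq_iff)
  qed simp
  let ?T = "\<lambda>\<kappa>. app_list (map (cre k) (sorted_list_of_multiset \<kappa>)) (app (Em k j) (shift j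
      (app_list (map (ann k) (sorted_list_of_multiset (lam - \<kappa>))) ?Z))) 1"
  have T: "?T \<kappa> = 0" if "\<kappa> \<subseteq># lam" "\<kappa> \<noteq> lam" for \<kappa>
  proof -
    have "lam - \<kappa> \<noteq> {#}"
      using that by (metis Diff_eq_empty_iff_mset subset_mset.antisym)
    then have "sorted_list_of_multiset (lam - \<kappa>) \<noteq> []"
      by (metis mset.simps(1) mset_sorted_list_of_multiset)
    then have "app (Em k j) (shift j
      (app_list (map (ann k) (sorted_list_of_multiset (lam - \<kappa>))) ?Z)) = (\<lambda>_. 0)"
      by (intro ext app_eq_0) (simp add: ann shift_def)
    then show ?thesis by (simp add: app_list_cre_0)
  qed
  have "Ybasis k (lam, j) (mon {#} 0) 1 = (\<Sum>\<kappa>\<in>{\<kappa>. \<kappa> \<subseteq># lam}.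
      sc (\<Prod>n\<in>set_mset lam. of_nat (count lam n choose count \<kappa> n)) (?T \<kappa>))"
    by (simp add: Ybasis_def Z)
  also have "\<dots> = (\<Sum>\<kappa>\<in>{lam}. sc (\<Prod>n\<in>set_mset lam. of_nat (count lam n choose count \<kappa> n)) (?T \<kappa>))"
    using T by (intro sum.mono_neutral_right) (auto simp: finite_submultisets)
  also have "\<dots> = ?T lam"
    by simp
  also have "?T lam = sc (of_int j) (mon (add_mset 1 lam) j)
    + (\<Sum>x\<in>#lam. sc (of_nat x) (mon (add_mset (x + 1) (lam - {#x#})) j))"
  proof -
    have E: "app (Em k j) (shift j ?Z) p = Em k j p (mon {#} j)" for p
      by (subst app_eq_single [where r=p]) (auto simp: shift_def elat_mon)
    have "app (Em k j) (shift j ?Z) p = 0" if "p < 0" for p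
      using that by (simp add: E Em_neg)
    moreover have "app (Em k j) (shift j ?Z) 0 = mon {#} j"
      by (simp add: E Em_deg_0)
    moreover have "app (Em k j) (shift j ?Z) 1 = sc (of_int j) (mon {#1#} j)"
      using heis_mon_neg [of 1 k "{#}" j] by (simp add: E Em_deg_1)
    ultimately show ?thesis
      using app_list_cre_deg_le_1 [of "sorted_list_of_multiset lam" "app (Em k j) (shift j ?Z)" j] assms
      by simp
  qed
  finally show ?thesis .
qed

lemma translation_in_W:
  assumes "0 \<notin># lam" "j \<noteq> 0"
  shows "sc (of_int j) (mon (add_mset 1 lam) j)
    + (\<Sum>x\<in>#lam. sc (of_nat x) (mon (add_mset (x + 1) (lam - {#x#})) j)) \<in> W k"
proof -
  have "mon {#} 0 \<in> VLplus"
    by (auto simp: VLplus_def VL_def theta_mon) (auto simp: mon_apply split: if_splits)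
  then show ?thesis
    using Ybasis_in_W [OF assms, of "mon {#} 0" k] unfolding Ybasis_vacuum [OF assms(1)] by blast
qed

section \<open>Products with quadratic Heisenberg vectors\<close>

text \<open>Coefficient of \<open>\<alpha>(-n-a-b-1) \<alpha>(n)\<close>, \<open>n \<ge> 0\<close>, in the (-2)-mode of \<open>\<alpha>(-a) \<alpha>(-b) 1\<close>.\<close>
definition gam :: "nat \<Rightarrow> nat \<Rightarrow> nat \<Rightarrow> int" where
  "gam a b n = (-1) ^ (b - 1) * int ((n + a + b) choose (a - 1)) * int ((n + b - 1) choose (b - 1))
    + (-1) ^ (a - 1) * int ((n + a + b) choose (b - 1)) * int ((n + a - 1) choose (a - 1))"

lemma app_cre_ann_deg_1:
  assumes "a \<ge> 1" "b \<ge> 1" "\<And>n. n > B \<Longrightarrow> heis k (int n) v = 0"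
  shows "app (cre k a) (\<lambda>p. ann k b p v) 1 = (\<Sum>n\<le>B.
    sc (of_int ((-1) ^ (b - 1) * int ((n + a + b) choose (a - 1)) * int ((n + b - 1) choose (b - 1))))
      (heis k (- int (n + a + b + 1)) (heis k (int n) v)))"
proof -
  \<comment> \<open>At \<open>z^(1-q)\<close> the annihilation factor is a multiple of
    \<open>\<alpha>(q-1-b)\<close> with nonnegative index, so the contributing \<open>q\<close> are
    \<open>n + b + 1\<close> with \<open>n \<ge> 0\<close>.\<close>
  have "app (cre k a) (\<lambda>p. ann k b p v) 1
      = (\<Sum>q\<in>(\<lambda>n. int (n + b + 1)) ` {..B}. cre k a q (ann k b (1 - q) v))"
  proof (rule app_eq_sum)
    fix q assume q: "q \<notin> (\<lambda>n. int (n + b + 1)) ` {..B}"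
    have "heis k (q - 1 - int b) v = 0" if nonneg: "q - 1 - int b \<ge> 0"
    proof -
      obtain n where n: "q = int (n + b + 1)"
        using nonneg zero_le_imp_eq_int [of "q - 1 - int b"] by (auto simp: algebra_simps)
      with q have "n > B"
        by (auto simp: linorder_not_less [symmetric])
      from assms(3) [OF this] n show ?thesis by simp
    qed
    then show "cre k a q (ann k b (1 - q) v) = 0"
      by (simp add: ann_def)
  qed simp
  also have "\<dots> = (\<Sum>n\<le>B. cre k a (int (n + b + 1)) (ann k b (1 - int (n + b + 1)) v))"
    by (subst sum.reindex) (auto simp: inj_on_def)
  also have "\<dots> = (\<Sum>n\<le>B.
    sc (of_int ((-1) ^ (b - 1) * int ((n + a + b) choose (a - 1)) * int ((n + b - 1) choose (b - 1))))
      (heis k (- int (n + a + b + 1)) (heis k (int n) v)))"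
  proof (rule sum.cong [OF refl])
    fix n
    have "nat (int b + int n - 1) = n + b - 1"
      using assms(2) by simp
    then have "ann k b (1 - int (n + b + 1)) v
        = sc ((-1) ^ (b - 1) * of_nat ((n + b - 1) choose (b - 1))) (heis k (int n) v)"
      by (simp add: ann_def)
    moreover have "n + b + 1 + a - 1 = n + a + b" "n + b + 1 + a = n + a + b + 1"
      by simp_all
    ultimately show "cre k a (int (n + b + 1)) (ann k b (1 - int (n + b + 1)) v)
        = sc (of_int ((-1) ^ (b - 1) * int ((n + a + b) choose (a - 1)) * int ((n + b - 1) choose (b - 1))))
          (heis k (- int (n + a + b + 1)) (heis k (int n) v))"
      using assms(1) by (simp only: cre_nonneg heis_sc) (simp add: mult_ac)
  qed
  finally show ?thesis .
qed

text \<open>If \<open>a = b\<close>, the sub-multisets \<open>{#a#}\<close> and \<open>{#b#}\<close>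
  coincide, and the weight "2 choose 1" makes up for it.\<close>

lemma sum_submultisets_pair:
  fixes G :: "nat multiset \<Rightarrow> vec"
  shows "(\<Sum>\<kappa>\<in>{\<kappa>. \<kappa> \<subseteq># {#a, b#}}.
      sc (\<Prod>n\<in>set_mset {#a, b#}. of_nat (count {#a, b#} n choose count \<kappa> n)) (G \<kappa>))
    = G {#} + G {#a#} + G {#b#} + G {#a, b#}"
proof (cases "a = b")
  case True
  have "sc 2 x = x + x" for x
    using sc_add_left [of 1 1 x] by simp
  then show ?thesis
    using True by (simp add: submultisets_add_mset add_ac)
next
  case False
  then show ?thesis
    by (simp add: submultisets_add_mset add_ac)
qed

text \<open>\<open>a \<le> b\<close> fixes the order of the sorted list. The first two terms come
  from both factors creating, the sum over \<open>n\<close> from one creating and one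
  annihilating.\<close>

lemma Ybasis_quadratic:
  assumes "1 \<le> a" "a \<le> b" and B: "\<And>n. n > B \<Longrightarrow> heis k (int n) v = 0"
  shows "Ybasis k ({#a, b#}, 0) v 1 =
    sc (of_nat b) (heis k (- int a) (heis k (- int (b + 1)) v))
    + sc (of_nat a) (heis k (- int (a + 1)) (heis k (- int b) v))
    + (\<Sum>n\<le>B. sc (of_int (gam a b n)) (heis k (- int (n + a + b + 1)) (heis k (int n) v)))"
proof -
  have b: "1 \<le> b" using assms by simp
  let ?Z = "\<lambda>p::int. if p = 0 then v else 0"
  have Z: "zb k 0 v = ?Z"
    by (auto simp: zb_def fun_eq_iff fun_apply)
  have sh: "shift 0 F = F" for F
    by (auto simp: shift_def elat_def fun_eq_iff)
  have at: "app A ?Z = (\<lambda>p. A p v)" if "\<And>q. A q 0 = 0" for A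
  proof
    fix p show "app A ?Z p = A p v"
      using that by (subst app_eq_single [where r=p]) auto
  qed
  let ?T = "\<lambda>\<kappa>. app_list (map (cre k) (sorted_list_of_multiset \<kappa>))
      (app_list (map (ann k) (sorted_list_of_multiset ({#a, b#} - \<kappa>))) ?Z) 1"
  have "Ybasis k ({#a, b#}, 0) v 1 = (\<Sum>\<kappa>\<in>{\<kappa>. \<kappa> \<subseteq># {#a, b#}}.
      sc (\<Prod>n\<in>set_mset {#a, b#}. of_nat (count {#a, b#} n choose count \<kappa> n)) (?T \<kappa>))"
    unfolding Ybasis_def by (simp only: Z sh app_Em_exponent_0 app_Ep_exponent_0 prod.case)
  also have "\<dots> = ?T {#} + ?T {#a#} + ?T {#b#} + ?T {#a, b#}"
    by (rule sum_submultisets_pair)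
  \<comment> \<open>Two annihilation factors produce only negative powers of
    \<open>z\<close>.\<close>
  also have "?T {#} = 0"
  proof -
    have "app (ann k a) (\<lambda>p. ann k b p v) 1 = 0"
      using assms b by (intro app_eq_0) (simp add: ann_def)
    then show ?thesis
      using assms by (simp add: at)
  qed
  also have "?T {#a#} = (\<Sum>n\<le>B.
    sc (of_int ((-1) ^ (b - 1) * int ((n + a + b) choose (a - 1)) * int ((n + b - 1) choose (b - 1))))
      (heis k (- int (n + a + b + 1)) (heis k (int n) v)))"
    using app_cre_ann_deg_1 [OF assms(1) b B] by (simp add: at)
  also have "?T {#b#} = (\<Sum>n\<le>B.
    sc (of_int ((-1) ^ (a - 1) * int ((n + a + b) choose (b - 1)) * int ((n + a - 1) choose (a - 1))))
      (heis k (- int (n + a + b + 1)) (heis k (int n) v)))"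
  proof -
    have "{#a, b#} - {#b#} = {#a#}" and "n + b + a = n + a + b" for n
      by (simp_all add: add_mset_commute [of a])
    with app_cre_ann_deg_1 [OF b assms(1) B] show ?thesis
      by (simp add: at)
  qed
  also have "?T {#a, b#} = sc (of_nat b) (heis k (- int a) (heis k (- int (b + 1)) v))
    + sc (of_nat a) (heis k (- int (a + 1)) (heis k (- int b) v))"
  proof -
    have "app (cre k a) (\<lambda>p. cre k b p v) 1 = (\<Sum>q\<in>{0, 1}. cre k a q (cre k b (1 - q) v))"
    proof (rule app_eq_sum)
      fix q :: int assume "q \<notin> {0, 1}"
      then have "q < 0 \<or> 1 - q < 0" by auto
      then show "cre k a q (cre k b (1 - q) v) = 0"
        using assms b by (auto simp: cre_neg)
    qed simp
    then show ?thesis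
      using assms b by (simp add: at cre_deg_0 cre_deg_1 heis_sc)
  qed
  finally show ?thesis
    unfolding gam_def of_int_add sc_add_left sum.distrib by (simp only: add_ac add_0_left)
qed

text \<open>\<open>\<alpha>(0)\<close> acts as the scalar \<open>ip k * m\<close>, while
  \<open>\<alpha>(n)\<close> removes an entry \<open>n\<close> and kills the monomial once
  \<open>n\<close> exceeds the degree. The correction terms are therefore shorter than the two
  leading monomials, as an induction on length requires.\<close>

lemma quadratic_in_W:
  assumes "1 \<le> a" "a \<le> b" "0 \<notin># \<nu>"
  shows "sc (of_nat b) (mon (add_mset a (add_mset (b + 1) \<nu>)) m)
    + sc (of_nat a) (mon (add_mset (a + 1) (add_mset b \<nu>)) m)
    + sc (of_int (gam a b 0 * (ip k * m))) (mon (add_mset (a + b + 1) \<nu>) m)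
    + (\<Sum>n\<in>{1..sum_mset \<nu>}. sc (of_int (gam a b n * int n * ip k * int (count \<nu> n)))
        (mon (add_mset (n + a + b + 1) (\<nu> - {#n#})) m)) \<in> W k"
proof -
  let ?B = "sum_mset \<nu>"
  have B: "heis k (int n) (mon \<nu> i) = 0" if "n > ?B" for n i
  proof -
    have "n \<notin># \<nu>"
      using that sum_mset.remove [of n \<nu>] by auto
    then show ?thesis
      using that by (subst heis_mon_pos) (auto simp: not_in_iff)
  qed
  then have B': "heis k (int n) (mon \<nu> m + theta (mon \<nu> m)) = 0" "heis k (int n) (theta (mon \<nu> m)) = 0"
    if "n > ?B" for n
    using that by (simp_all add: theta_mon heis_add heis_sc)
  note Yb = Ybasis_quadratic [OF assms(1,2), where B="?B"]
  have "Ybasis k ({#a, b#}, 0) (mon \<nu> m) 1 \<in> W k"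
    using assms by (intro Ybasis_exponent_0_in_W)
      (auto simp: Yb B B' heis_add sc_add_right sum.distrib add_ac)
  also have "Ybasis k ({#a, b#}, 0) (mon \<nu> m) 1 =
    sc (of_nat b) (mon (add_mset a (add_mset (b + 1) \<nu>)) m)
    + sc (of_nat a) (mon (add_mset (a + 1) (add_mset b \<nu>)) m)
    + (\<Sum>n\<le>?B. sc (of_int (gam a b n)) (heis k (- int (n + a + b + 1)) (heis k (int n) (mon \<nu> m))))"
    (is "_ = ?X + ?Y + ?S")
    using assms heis_mon_neg [of "b + 1"] heis_mon_neg [of "a + 1"]
    by (simp add: Yb B heis_mon_neg del: of_nat_add of_nat_Suc)
  also have "?S = sc (of_int (gam a b 0 * (ip k * m))) (mon (add_mset (a + b + 1) \<nu>) m)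
    + (\<Sum>n\<in>{1..?B}. sc (of_int (gam a b n * int n * ip k * int (count \<nu> n)))
        (mon (add_mset (n + a + b + 1) (\<nu> - {#n#})) m))"
  proof -
    have "heis k (- int (n + a + b + 1)) (mon \<mu> m) = mon (add_mset (n + a + b + 1) \<mu>) m" for n \<mu>
      by (rule heis_mon_neg) simp
    note this this [of 0]
    moreover have "{..?B} = insert 0 {1..?B}"
      by auto
    ultimately show ?thesis
      by (simp add: heis_mon_zero heis_mon_pos heis_sc mult_ac del: of_nat_add of_nat_Suc)
  qed
  finally show ?thesis
    by (simp add: add_ac)
qed

section \<open>Reduction to monomials of length one\<close>

definition R :: "nat \<Rightarrow> int \<Rightarrow> nat \<Rightarrow> vec set" where
  "R k m N = {f. \<exists>c. f - sc c (mon {#N#} m) \<in> W k}"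

lemma W_imp_R: "f \<in> W k \<Longrightarrow> f \<in> R k m N"
  by (auto simp: R_def intro: exI [of _ 0])

lemma R_mon: "mon {#N#} m \<in> R k m N"
  by (auto simp: R_def intro: exI [of _ 1])

lemma R_add:
  assumes "f \<in> R k m N" "g \<in> R k m N"
  shows "f + g \<in> R k m N"
proof -
  obtain c d where "f - sc c (mon {#N#} m) \<in> W k" "g - sc d (mon {#N#} m) \<in> W k"
    using assms by (auto simp: R_def)
  from W_add [OF this] have "f + g - sc (c + d) (mon {#N#} m) \<in> W k"
    by (simp add: sc_add_left algebra_simps)
  then show ?thesis by (auto simp: R_def)
qed

lemma R_sc:
  assumes "f \<in> R k m N"
  shows "sc c f \<in> R k m N"
proof -
  obtain d where "f - sc d (mon {#N#} m) \<in> W k"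
    using assms by (auto simp: R_def)
  from W_sc [OF this, of c] have "sc c f - sc (c * d) (mon {#N#} m) \<in> W k"
    by (simp add: sc_diff_right)
  then show ?thesis by (auto simp: R_def)
qed

lemma R_cancel:
  assumes "sc c f + g \<in> R k m N" "g \<in> R k m N" "c \<noteq> 0"
  shows "f \<in> R k m N"
proof -
  have "sc (1 / c) (sc c f + g + sc (-1) g) \<in> R k m N"
    by (rule R_sc [OF R_add [OF assms(1) R_sc [OF assms(2)]]])
  then show ?thesis
    using assms(3) by (simp add: sc_minus_one)
qed

lemma R_sum: "(\<And>x. x \<in> A \<Longrightarrow> f x \<in> R k m N) \<Longrightarrow> (\<Sum>x\<in>A. f x) \<in> R k m N"
  by (induction A rule: infinite_finite_induct) (simp_all add: R_add W_imp_R)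

lemma R_sum_mset: "(\<And>x. x \<in># A \<Longrightarrow> f x \<in> R k m N) \<Longrightarrow> (\<Sum>x\<in>#A. f x) \<in> R k m N"
  by (induction A) (simp_all add: R_add W_imp_R)

text \<open>Outer induction on the length, inner induction on the smaller entry of a chosen pair;
  the degree stays fixed throughout. \<open>m \<noteq> 0\<close> allows division by the leading
  coefficient of the translation relation that ends the inner induction.\<close>

lemma mon_in_R:
  assumes "m \<noteq> 0" "\<nu> \<noteq> {#}" "0 \<notin># \<nu>"
  shows "mon \<nu> m \<in> R k m (sum_mset \<nu>)"
  using assms(2,3)
proof (induction "size \<nu>" arbitrary: \<nu> rule: less_induct)
  case less
  have shorter: "mon \<mu> m \<in> R k m N"
    if "size \<mu> < size \<nu>" "\<mu> \<noteq> {#}" "0 \<notin># \<mu>" "sum_mset \<mu> = N" for \<mu> N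
    using less.hyps that by blast
  text \<open>The quadratic relations trade x for x - 1 in a pair of entries until the translation
    operator applies.\<close>
  have pair: "mon (add_mset x (add_mset y q)) m \<in> R k m N"
    if "1 \<le> x" "x \<le> y" "0 \<notin># q" "size q + 2 = size \<nu>" "x + y + sum_mset q = N" for x y q N
    using that
  proof (induction x arbitrary: y)
    case (Suc a)
    show ?case
    proof (cases "a = 0")
      case True
      \<comment> \<open>The translation relation for \<open>?l\<close> expresses the monomial with
        an entry 1 through monomials with one factor fewer.\<close>
      let ?l = "add_mset y q"
      let ?S = "\<Sum>x\<in>#?l. sc (of_nat x) (mon (add_mset (x + 1) (?l - {#x#})) m)"
      have S: "?S \<in> R k m N"
      proof (intro R_sum_mset R_sc shorter)
        fix x assume x: "x \<in># ?l"
        have "size (?l - {#x#}) = size q" "sum_mset ?l = x + sum_mset (?l - {#x#})"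
          using x size_Diff_singleton [OF x] sum_mset.remove [OF x] by simp_all
        then show "size (add_mset (x + 1) (?l - {#x#})) < size \<nu>"
          "sum_mset (add_mset (x + 1) (?l - {#x#})) = N"
          using Suc.prems True by simp_all
        show "0 \<notin># add_mset (x + 1) (?l - {#x#})"
          using Suc.prems by (auto dest: in_diffD)
      qed simp
      have "sc (of_int m) (mon (add_mset 1 ?l) m) + ?S \<in> R k m N"
        using Suc.prems assms(1) by (intro W_imp_R translation_in_W) auto
      from R_cancel [OF this S] show ?thesis
        using assms(1) True by simp
    next
      case False
      \<comment> \<open>The relation for the pair \<open>(a, y)\<close>: \<open>?X\<close> has the
        smaller first entry \<open>a\<close> and falls to the inner induction, \<open>?Z\<close> and
        \<open>?S\<close> are shorter, and the coefficient \<open>a\<close> of the wanted monomial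
        is nonzero.\<close>
      let ?X = "sc (of_nat y) (mon (add_mset a (add_mset (y + 1) q)) m)"
      let ?Z = "sc (of_int (gam a y 0 * (ip k * m))) (mon (add_mset (a + y + 1) q) m)"
      let ?S = "\<Sum>n\<in>{1..sum_mset q}. sc (of_int (gam a y n * int n * ip k * int (count q n)))
        (mon (add_mset (n + a + y + 1) (q - {#n#})) m)"
      have "?X + sc (of_nat a) (mon (add_mset (a + 1) (add_mset y q)) m) + ?Z + ?S \<in> R k m N"
        using Suc.prems False by (intro W_imp_R quadratic_in_W) auto
      moreover have "?X \<in> R k m N"
        using Suc.prems False by (intro R_sc Suc.IH) auto
      moreover have "?Z \<in> R k m N"
        using Suc.prems by (intro R_sc shorter) auto
      moreover have "?S \<in> R k m N"
      proof (intro R_sum)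
        fix n
        show "sc (of_int (gam a y n * int n * ip k * int (count q n)))
          (mon (add_mset (n + a + y + 1) (q - {#n#})) m) \<in> R k m N"
        proof (cases "n \<in># q")
          case True
          have "size q = Suc (size (q - {#n#}))" "sum_mset q = n + sum_mset (q - {#n#})"
            using True by (metis insert_DiffM size_add_mset, metis sum_mset.remove)
          then show ?thesis
            using Suc.prems by (intro R_sc shorter) (auto dest: in_diffD)
        qed (simp add: not_in_iff W_imp_R)
      qed
      ultimately show ?thesis
        using False R_cancel [of "of_nat a" "mon (add_mset (Suc a) (add_mset y q)) m" "?X + ?Z + ?S" k m N]
        by (simp add: R_add add_ac)
    qed
  qed simp
  show ?case
  proof (cases "size \<nu> = 1")
    case True
    then obtain x where "\<nu> = {#x#}"
      using size_1_singleton_mset by blast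
    then show ?thesis by (simp add: R_mon)
  next
    case False
    obtain x \<mu> where x: "\<nu> = add_mset x \<mu>"
      using less.prems by (metis multiset_cases)
    then obtain y q where y: "\<mu> = add_mset y q"
      using False by (metis multiset_cases size_single One_nat_def)
    show ?thesis
    proof (cases "x \<le> y")
      case True
      then show ?thesis
        using pair [of x y q] less.prems x y by (simp add: add_ac Suc_le_eq)
    next
      case False
      then show ?thesis
        using pair [of y x q] less.prems x y by (simp add: add_ac Suc_le_eq add_mset_commute)
    qed
  qed
qed

lemma R_subset_W:
  assumes "mon {#N#} m \<in> W k" "f \<in> R k m N"
  shows "f \<in> W k"
proof -
  obtain c where "f - sc c (mon {#N#} m) \<in> W k"
    using assms(2) by (auto simp: R_def)
  from W_add [OF this W_sc [OF assms(1), of c]] show ?thesis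
    by simp
qed

section \<open>High degrees\<close>

text \<open>The binomial is "n + 4 choose 3", which is large enough to outweigh the alternating term
  in \<open>gam 2 (n + 2) 0\<close>.\<close>

lemma choose_ge_self: "n + 4 \<le> (n + 4) choose (n + 1)"
proof -
  have "n + 4 \<le> (n + 4) choose 3"
    by (induction n) (auto simp: numeral_eq_Suc)
  also have "(n + 4) choose 3 = (n + 4) choose (n + 1)"
    using binomial_symmetric [of 3 "n + 4"] by simp
  finally show ?thesis .
qed

text \<open>The values are \<open>C(n+4,2) + (-1)^n\<close> and
  \<open>(-1)^(n+1) (n+4) - C(n+4,3)\<close>. Their signs are all that the positivity estimate below
  uses.\<close>

lemma gam_signs: "gam 1 (n + 3) 0 \<ge> 0" "gam 2 (n + 2) 0 \<le> 0"
proof -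
  have "(n + 4) choose (n + 2) \<ge> 1"
    by (simp add: Suc_le_eq)
  then have "int ((n + 4) choose (n + 2)) \<ge> 1"
    by linarith
  then show "gam 1 (n + 3) 0 \<ge> 0"
    by (cases "even n") (simp_all add: gam_def add_ac)
  have "int ((n + 4) choose (n + 1)) \<ge> int n + 4"
    using choose_ge_self [of n] by linarith
  moreover have "(-1) ^ (n + 1) * (int n + 4) \<le> int n + 4"
    by (cases "even n") auto
  moreover have "gam 2 (n + 2) 0 = (-1) ^ (n + 1) * (int n + 4) - int ((n + 4) choose (n + 1))"
  proof -
    have "0 + 2 + (n + 2) = n + 4" "n + 2 - 1 = n + 1" "0 + (n + 2) - 1 = n + 1" "2 - 1 = (1::nat)"
      "0 + 2 - 1 = (1::nat)"
      by simp_all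
    then show ?thesis
      unfolding gam_def by (simp only: binomial_n_n choose_one) simp
  qed
  ultimately show "gam 2 (n + 2) 0 \<le> 0"
    by linarith
qed

text \<open>The five relations in degree n + 5 between the monomials of length at most three
  determine the single generator H up to the factor on the left.\<close>
lemma elimination_identity:
  fixes X Y Z T H M c K n d e :: complex
  assumes "c = K * M"
  shows "c * (- (c * M * (n + 5 - 3) * d) + c * M * e - 2 * (n + 5 - 3) - 2 * e
      + (n + 5 - 1) * (n + 5 - 2) * (n + 5 - 3)) * H
    = c * M * (((n + 2) * Y + 2 * Z + e * c * H) + - (n + 2) * ((n + 3) * X + Y + d * c * H))
      + - M * (2 * T + 2 * c * Z + 2 * (n + 2) * K * H)
      + 2 * ((M * T + 2 * Z + (n + 2) * Y) + - 1 * ((n + 2) * Y + 2 * Z + e * c * H))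
      + c * (n + 5 - 2) * (n + 5 - 3) * (M * X + (n + 4) * H)"
  unfolding assms by (simp add: algebra_simps)

text \<open>Two translation relations (\<open>r1\<close>, \<open>r4\<close>) and three quadratic
  ones (\<open>r2\<close>, \<open>r3\<close>, \<open>r5\<close>) link five monomials of degree
  \<open>n + 5\<close>. Eliminating all but \<open>?H\<close> leaves the factor
  \<open>c * b\<close>, which sign considerations show to be nonzero.\<close>

lemma high_degree_in_W:
  assumes "k > 0" "m > 0"
  shows "mon {#n + 5#} m \<in> W k"
proof -
  let ?X = "mon {#1, n + 4#} m" and ?Y = "mon {#2, n + 3#} m" and ?Z = "mon {#3, n + 2#} m"
    and ?T = "mon {#1, 2, n + 2#} m" and ?H = "mon {#n + 5#} m"
  define M c d1 d2 :: int where "M = m" and "c = ip k * m"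
    and "d1 = gam 1 (n + 3) 0" and "d2 = gam 2 (n + 2) 0"
  have r1: "sc (of_int M) ?X + sc (of_nat (n + 4)) ?H \<in> W k"
    using translation_in_W [of "{#n + 4#}" m k] assms by (simp add: M_def add_ac)
  have r2: "sc (of_nat (n + 3)) ?X + ?Y + sc (of_int (d1 * c)) ?H \<in> W k"
    using quadratic_in_W [of 1 "n + 3" "{#}" m k] by (simp add: c_def d1_def add_ac numeral_eq_Suc)
  have r3: "sc (of_nat (n + 2)) ?Y + sc 2 ?Z + sc (of_int (d2 * c)) ?H \<in> W k"
    using quadratic_in_W [of 2 "n + 2" "{#}" m k] by (simp add: c_def d2_def add_ac numeral_eq_Suc)
  have r4: "sc (of_int M) ?T + sc 2 ?Z + sc (of_nat (n + 2)) ?Y \<in> W k"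
    using translation_in_W [of "{#2, n + 2#}" m k] assms
    by (simp add: M_def add_ac numeral_eq_Suc add_mset_commute)
  \<comment> \<open>For \<open>a = b = 1\<close> both leading monomials are \<open>?T\<close>,
    \<open>gam 1 1 j\<close> is always 2, and only \<open>j = n + 2\<close> occurs among the
    entries.\<close>
  have r5: "sc 2 ?T + sc (of_int (2 * c)) ?Z + sc (of_int (2 * (int n + 2) * ip k)) ?H \<in> W k"
  proof -
    have "(\<Sum>j\<in>{1..n + 2}. sc (of_int (gam 1 1 j * int j * ip k * int (count {#n + 2#} j)))
        (mon (add_mset (j + 1 + 1 + 1) ({#n + 2#} - {#j#})) m))
      = (\<Sum>j\<in>{n + 2}. sc (of_int (gam 1 1 j * int j * ip k * int (count {#n + 2#} j)))
        (mon (add_mset (j + 1 + 1 + 1) ({#n + 2#} - {#j#})) m))"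
      by (intro sum.mono_neutral_right) auto
    then have "?T + (mon {#2, 1, n + 2#} m + (sc (of_int (2 * c)) ?Z
        + sc (of_int (2 * (int n + 2) * ip k)) ?H)) \<in> W k"
      using quadratic_in_W [of 1 1 "{#n + 2#}" m k]
      by (simp add: c_def gam_def add_ac mult_ac numeral_eq_Suc)
    moreover have "{#2, 1, n + 2#} = {#1, 2, n + 2#}"
      by (simp add: add_mset_commute)
    moreover have "sc 2 ?T = ?T + ?T"
      using sc_add_left [of 1 1 ?T] by simp
    ultimately show ?thesis
      by (simp only: add.assoc)
  qed
  let ?N = "int n + 5"
  define b where "b = - (c * M * (?N - 3) * d1) + c * M * d2 - 2 * (?N - 3) - 2 * d2
    + (?N - 1) * (?N - 2) * (?N - 3)"
  \<comment> \<open>\<open>c * M\<close> is \<open>-2 k m^2\<close>: this is where negative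
    definiteness enters, and it makes the two \<open>gam\<close> terms of \<open>b\<close> carrying
    this factor nonnegative.\<close>
  have cM: "c * M \<le> 0"
    using assms by (simp add: c_def M_def ip_def)
  have "- (c * M * (?N - 3) * d1) + c * M * d2 \<ge> 0"
  proof -
    have "0 \<le> (?N - 3) * d1" "d2 \<le> 0"
      using gam_signs [of n] by (simp_all add: d1_def d2_def)
    then have "c * M * ((?N - 3) * d1) \<le> 0" "c * M * d2 \<ge> 0"
      using cM by (auto intro: mult_nonpos_nonneg mult_nonpos_nonpos)
    then show ?thesis by (simp add: mult.assoc)
  qed
  \<comment> \<open>\<open>?N \<ge> 5\<close> gives \<open>(?N - 1) * (?N - 2) \<ge> 12\<close>, so
    the cubic term outweighs the one remaining negative term of \<open>b\<close>.\<close>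
  moreover have "(?N - 1) * (?N - 2) * (?N - 3) > 2 * (?N - 3)"
    by (simp add: algebra_simps add_pos_nonneg)
  moreover have "d2 \<le> 0"
    using gam_signs by (simp add: d2_def)
  ultimately have "b > 0"
    by (simp add: b_def)
  moreover have "c \<noteq> 0"
    using assms by (simp add: c_def ip_def)
  ultimately have "of_int (c * b) \<noteq> (0::complex)"
    by simp
  moreover have "sc (of_int (c * b)) ?H \<in> W k"
  proof -
    let ?comb = "\<lambda>r1 r2 r3 r4 r5. sc (of_int (c * M)) (r3 + sc (- of_nat (n + 2)) r2)
      + sc (- of_int M) r5 + sc 2 (r4 + sc (-1) r3)
      + sc (of_int (c * (?N - 2) * (?N - 3))) r1"
    have "sc (of_int (c * b)) ?H = ?comb
        (sc (of_int M) ?X + sc (of_nat (n + 4)) ?H)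
        (sc (of_nat (n + 3)) ?X + ?Y + sc (of_int (d1 * c)) ?H)
        (sc (of_nat (n + 2)) ?Y + sc 2 ?Z + sc (of_int (d2 * c)) ?H)
        (sc (of_int M) ?T + sc 2 ?Z + sc (of_nat (n + 2)) ?Y)
        (sc 2 ?T + sc (of_int (2 * c)) ?Z + sc (of_int (2 * (int n + 2) * ip k)) ?H)"
    proof
      fix p
      have "of_int c = of_int (ip k) * (of_int M :: complex)"
        by (simp add: c_def M_def)
      \<comment> \<open>Vectors are compared pointwise, so the scalar identity is applied to the
        values at the basis index \<open>p\<close>.\<close>
      from elimination_identity [OF this, where d="of_int d1" and e="of_int d2"
          and n="of_nat n" and H="?H p" and X="?X p" and Y="?Y p" and Z="?Z p" and T="?T p"]
      show "sc (of_int (c * b)) ?H p = ?comb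
          (sc (of_int M) ?X + sc (of_nat (n + 4)) ?H)
          (sc (of_nat (n + 3)) ?X + ?Y + sc (of_int (d1 * c)) ?H)
          (sc (of_nat (n + 2)) ?Y + sc 2 ?Z + sc (of_int (d2 * c)) ?H)
          (sc (of_int M) ?T + sc 2 ?Z + sc (of_nat (n + 2)) ?Y)
          (sc 2 ?T + sc (of_int (2 * c)) ?Z + sc (of_int (2 * (int n + 2) * ip k)) ?H) p"
        unfolding sc_def fun_apply b_def by (simp add: add_ac)
    qed
    also have "\<dots> \<in> W k"
      by (intro W_add W_sc r1 r2 r3 r4 r5)
    finally show ?thesis .
  qed
  ultimately show ?thesis
    using W_sc_cancel by blast
qed

lemma mon_in_W_of_degree_ge_5:
  assumes "k > 0" "m > 0" "0 \<notin># \<nu>" "sum_mset \<nu> \<ge> 5"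
  shows "mon \<nu> m \<in> W k"
proof -
  have "sum_mset \<nu> - 5 + 5 = sum_mset \<nu>" "\<nu> \<noteq> {#}"
    using assms by auto
  then show ?thesis
    using R_subset_W [OF _ mon_in_R [of m \<nu> k]] high_degree_in_W [OF assms(1,2), of "sum_mset \<nu> - 5"] assms
    by simp
qed

section \<open>Products of vectors with nonzero lattice degree\<close>

text \<open>The pairing of \<open>i \<alpha>\<close> with \<open>j \<alpha>\<close> is
  \<open>-N\<close>, so \<open>z^(i \<alpha>)\<close> moves the two exponentials to opposite powers
  of \<open>z\<close>.\<close>

lemma zb_exponential_pair:
  assumes "int N = 2 * int k * i * j" "j \<noteq> 0"
  shows "zb k i (mon {#} j + mon {#} (-j)) s
    = (if s = - int N then mon {#} j else 0) + (if s = int N then mon {#} (-j) else 0)"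
proof
  fix x :: "nat multiset \<times> int"
  obtain \<mu> m where x: "x = (\<mu>, m)" by (cases x)
  have N: "ip k * i * j = - int N"
    using assms by (simp add: ip_def)
  consider "m = j" | "m = -j" | "m \<noteq> j" "m \<noteq> -j" by blast
  then show "zb k i (mon {#} j + mon {#} (-j)) s x
    = ((if s = - int N then mon {#} j else 0) + (if s = int N then mon {#} (-j) else 0)) x"
  proof cases
    case 1
    then show ?thesis
      using assms(2) N by (auto simp: x zb_def fun_apply mon_apply)
  next
    case 2
    then have "ip k * i * m = int N"
      using N by simp
    then show ?thesis
      using 2 assms(2) by (auto simp: x zb_def fun_apply mon_apply)
  next
    case 3
    then show ?thesis
      by (auto simp: x zb_def fun_apply mon_apply)
  qed
qed

text \<open>On pure exponentials \<open>\<alpha>(0)\<close> is the only surviving annihilator, at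
  \<open>z^(-p)\<close>. Since \<open>p + 1 = r + N\<close>, reaching \<open>z^1\<close> takes
  degree \<open>r\<close> of \<open>Em\<close> on the part from \<open>e^(-j \<alpha>)\<close> and
  degree \<open>r + 2 N\<close> on the part from \<open>e^(j \<alpha>)\<close>. In the creation term
  the former would need total degree \<open>1 - N < 0\<close>, and the latter distributes
  \<open>N + 1\<close> between \<open>cre\<close> and \<open>Em\<close>.\<close>

lemma Ybasis_exponential_pair:
  assumes N: "int N = 2 * int k * i * j" "N \<ge> 2" and p: "p + 1 = r + N" and "j \<noteq> 0"
  shows "Ybasis k ({#p#}, i) (mon {#} j + mon {#} (-j)) 1 =
    sc ((-1) ^ (p - 1) * of_int (- (ip k * j))) (Em k i (int r) (mon {#} (i - j)))
    + sc ((-1) ^ (p - 1) * of_int (ip k * j)) (Em k i (int (r + 2 * N)) (mon {#} (i + j)))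
    + (\<Sum>d\<le>N + 1. cre k p (int d) (Em k i (int (N + 1 - d)) (mon {#} (i + j))))"
proof -
  have p1: "p \<ge> 1" using N p by simp
  define Z :: ser where "Z = (\<lambda>s. (if s = - int N then mon {#} j else 0)
    + (if s = int N then mon {#} (-j) else 0))"
  have "zb k i (mon {#} j + mon {#} (-j)) = Z"
    using zb_exponential_pair [OF N(1) assms(4)] by (auto simp: Z_def)
  moreover have "app (Ep k i) Z = Z"
    by (rule ext, rule app_Ep_no_oscillators) (auto simp: Z_def fun_apply mon_apply split: if_splits)
  ultimately have Ep: "app (Ep k i) (zb k i (mon {#} j + mon {#} (-j))) = Z"
    by simp
  have heis_Z: "heis k n (Z s) = 0" if "n > 0" for n s
    using that heis_mon_pos [of "nat n" k "{#}"] by (auto simp: Z_def heis_add)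
  have annZ: "app (ann k p) Z s = sc ((-1) ^ (p - 1)) (heis k 0 (Z (s + int p)))" for s
  proof -
    have "nat (int p - 1) = p - 1" by simp
    then show ?thesis
      by (subst app_eq_single [where r="- int p"]) (auto simp: ann_def heis_Z)
  qed
  have T1: "app (Em k i) (shift i (app (ann k p) Z)) 1
      = sc ((-1) ^ (p - 1) * of_int (- (ip k * j))) (Em k i (int r) (mon {#} (i - j)))
      + sc ((-1) ^ (p - 1) * of_int (ip k * j)) (Em k i (int (r + 2 * N)) (mon {#} (i + j)))"
  proof -
    have p': "int p = int r + int N - 1" using p by linarith
    have "app (Em k i) (shift i (app (ann k p) Z)) 1 = (\<Sum>q\<in>{int r, int (r + 2 * N)}.
        Em k i q (shift i (app (ann k p) Z) (1 - q)))"
    proof (rule app_eq_sum)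
      fix q assume "q \<notin> {int r, int (r + 2 * N)}"
      then have "Z (1 - q + int p) = 0"
        using p' by (auto simp: Z_def)
      then show "Em k i q (shift i (app (ann k p) Z) (1 - q)) = 0"
        by (simp add: shift_def annZ)
    qed simp
    moreover have "Z (1 - int r + int p) = mon {#} (-j)" "Z (1 - int (r + 2 * N) + int p) = mon {#} j"
      using p' N(2) by (auto simp: Z_def)
    moreover have "int r \<noteq> int (r + 2 * N)"
      using N(2) by simp
    ultimately show ?thesis
      by (simp add: shift_def annZ heis_mon_zero elat_sc elat_mon Em_sc add.commute
          del: of_nat_add of_nat_mult)
  qed
  have T2: "app (cre k p) (app (Em k i) (shift i Z)) 1
      = (\<Sum>d\<le>N + 1. cre k p (int d) (Em k i (int (N + 1 - d)) (mon {#} (i + j))))"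
  proof -
    have E: "app (Em k i) (shift i Z) s
        = Em k i (s + int N) (mon {#} (i + j)) + Em k i (s - int N) (mon {#} (i - j))" for s
    proof -
      have "app (Em k i) (shift i Z) s
          = (\<Sum>q\<in>{s + int N, s - int N}. Em k i q (shift i Z (s - q)))"
        by (rule app_eq_sum) (auto simp: shift_def Z_def)
      then show ?thesis
        using N(2) by (simp add: shift_def Z_def elat_mon add.commute)
    qed
    have "app (cre k p) (app (Em k i) (shift i Z)) 1
        = (\<Sum>d\<in>int ` {..N + 1}. cre k p d (app (Em k i) (shift i Z) (1 - d)))"
    proof (rule app_eq_sum)
      fix d assume d: "d \<notin> int ` {..N + 1}"
      show "cre k p d (app (Em k i) (shift i Z) (1 - d)) = 0"
      proof (cases "d < 0")
        case True
        then show ?thesis using p1 by (simp add: cre_neg)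
      next
        case False
        then obtain e where "d = int e"
          by (metis linorder_not_less nonneg_int_cases)
        with d have "d > int (N + 1)" by auto
        then show ?thesis by (simp add: E Em_neg)
      qed
    qed simp
    also have "\<dots> = (\<Sum>d\<le>N + 1. cre k p (int d) (app (Em k i) (shift i Z) (1 - int d)))"
      by (subst sum.reindex) auto
    also have "\<dots> = (\<Sum>d\<le>N + 1. cre k p (int d) (Em k i (int (N + 1 - d)) (mon {#} (i + j))))"
    proof (rule sum.cong [OF refl])
      fix d assume "d \<in> {..N + 1}"
      then have "1 - int d + int N = int (N + 1 - d)"
        by auto
      moreover have "Em k i (1 - int d - int N) (mon {#} (i - j)) = 0"
        using N(2) by (simp add: Em_neg)
      ultimately show "cre k p (int d) (app (Em k i) (shift i Z) (1 - int d))
          = cre k p (int d) (Em k i (int (N + 1 - d)) (mon {#} (i + j)))"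
        by (simp add: E)
    qed
    finally show ?thesis .
  qed
  show ?thesis
    unfolding Ybasis_def prod.case Ep using T1 T2
    by (simp add: submultisets_add_mset)
qed

lemma Em_mon_in_W:
  assumes "k > 0" "m > 0" "i > m"
  shows "Em k i (int r) (mon {#} m) \<in> W k"
proof -
  \<comment> \<open>Chosen so that \<open>i - j = m\<close> is the target exponent, while
    \<open>i + j\<close> is still positive.\<close>
  define j where "j = i - m"
  define N where "N = nat (2 * int k * i * j)"
  define p where "p = r + N - 1"
  have j: "j > 0" "i \<ge> 2" using assms by (auto simp: j_def)
  \<comment> \<open>The resulting \<open>N \<ge> 4\<close> makes the degree \<open>r + 2 N\<close>
    of the \<open>e^((i+j) \<alpha>)\<close> component at least 8, inside the range already
    settled.\<close>
  have "1 * 2 * 1 \<le> int k * i * j"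
    using j assms by (intro mult_mono) auto
  then have "4 \<le> 2 * int k * i * j"
    by (simp add: mult_ac)
  then have N: "int N = 2 * int k * i * j" "N \<ge> 4"
    unfolding N_def by linarith+
  have p: "p + 1 = r + N" "0 \<notin># {#p#}"
    using N(2) by (auto simp: p_def)
  have "mon {#} j + mon {#} (-j) \<in> VLplus"
    using mon_symm_in_VLplus [of "{#}" j] by (simp add: theta_mon)
  with p(2) have Y: "Ybasis k ({#p#}, i) (mon {#} j + mon {#} (-j)) 1 \<in> W k"
    using j by (intro Ybasis_in_W) auto
  have X: "sc c (Em k i (int (r + 2 * N)) (mon {#} (i + j))) \<in> W k" for c
    unfolding Em_mon using assms j N
    by (intro W_sc W_sum mon_in_W_of_degree_ge_5) (auto simp: parts_def)
  have C: "(\<Sum>d\<le>N + 1. cre k p (int d) (Em k i (int (N + 1 - d)) (mon {#} (i + j)))) \<in> W k"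
  proof (rule W_sum)
    fix d assume d: "d \<in> {..N + 1}"
    have "heis k (- int (d + p)) (mon \<nu> (i + j)) \<in> W k" if "\<nu> \<in> parts (N + 1 - d)" for \<nu>
    proof -
      \<comment> \<open>The degree does not depend on \<open>d\<close>:
        \<open>(d + p) + (N + 1 - d) = p + N + 1 = r + 2 N\<close>.\<close>
      have "sum_mset (add_mset (d + p) \<nu>) = r + 2 * N"
        using that d p by (auto simp: parts_def)
      then have "mon (add_mset (d + p) \<nu>) (i + j) \<in> W k"
        using that assms j N p by (intro mon_in_W_of_degree_ge_5) (auto simp: parts_def)
      then show ?thesis
        using p by (subst heis_mon_neg) auto
    qed
    moreover have "p \<ge> 1" using p by auto
    ultimately show "cre k p (int d) (Em k i (int (N + 1 - d)) (mon {#} (i + j))) \<in> W k"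
      unfolding Em_mon by (simp only: cre_nonneg heis_sum heis_sc) (intro W_sc W_sum; blast)
  qed
  have "N \<ge> 2" "j \<noteq> 0"
    using N j by auto
  \<comment> \<open>Both contributions to \<open>e^((i+j) \<alpha>)\<close> are cancelled; the
    remaining coefficient is \<open>ip k * j\<close> up to sign, nonzero because \<open>k\<close>
    and \<open>j\<close> are positive.\<close>
  note Y [unfolded Ybasis_exponential_pair [OF N(1) this(1) p(1) this(2)]]
  from W_sc_cancel [OF W_add_cancel [OF W_add_cancel [OF this C] X]]
  have "Em k i (int r) (mon {#} (i - j)) \<in> W k"
    using assms j by (simp add: ip_def)
  then show ?thesis
    by (simp add: j_def)
qed

section \<open>Low degrees\<close>

text \<open>Modulo \<open>W\<close> every monomial of degree \<open>r\<close> is a multiple of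
  \<open>mon {#r#} m\<close>, so the degree \<open>r\<close> part of the exponential becomes
  \<open>P(i)\<close> times it with \<open>P(z) = \<Sum> a s z^s\<close>. A nonzero \<open>P\<close>
  has finitely many roots, so \<open>P(i) \<noteq> 0\<close> for some integer
  \<open>i > m\<close>.\<close>

lemma mon_single_in_W:
  assumes "k > 0" "m > 0" "r > 0"
  shows "mon {#r#} m \<in> W k"
proof -
  have "\<exists>c. mon \<nu> m - sc c (mon {#r#} m) \<in> W k" if "\<nu> \<in> parts r" for \<nu>
  proof -
    have "\<nu> \<noteq> {#}" "0 \<notin># \<nu>" "sum_mset \<nu> = r"
      using that assms by (auto simp: parts_def)
    then show ?thesis
      using mon_in_R [of m \<nu> k] assms by (auto simp: R_def)
  qed
  then obtain c' where c': "\<And>\<nu>. \<nu> \<in> parts r \<Longrightarrow> mon \<nu> m - sc (c' \<nu>) (mon {#r#} m) \<in> W k"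
    by metis
  \<comment> \<open>The constant chosen for \<open>{#r#}\<close> itself need not be 1; normalising
    it makes the linear coefficient \<open>a 1 = 1 / r\<close>.\<close>
  define c where "c = c'({#r#} := 1)"
  have c: "mon \<nu> m - sc (c \<nu>) (mon {#r#} m) \<in> W k" if "\<nu> \<in> parts r" for \<nu>
    using c' [OF that] by (simp add: c_def)
  define w where "w \<nu> = (\<Prod>n\<in>set_mset \<nu>. 1 / of_nat n ^ count \<nu> n / fact (count \<nu> n) :: complex)" for \<nu>
  define a where "a s = (\<Sum>\<nu>\<in>{\<nu> \<in> parts r. size \<nu> = s}. w \<nu> * c \<nu>)" for s
  have size: "size \<nu> \<le> r" if "\<nu> \<in> parts r" for \<nu>
  proof -
    have "0 \<notin># \<nu> \<Longrightarrow> size \<nu> \<le> sum_mset \<nu>"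
      by (induction \<nu>) auto
    then show ?thesis using that by (simp add: parts_def)
  qed
  have "{\<nu> \<in> parts r. size \<nu> = 1} = {{#r#}}"
    using assms by (auto simp: parts_def dest!: size_1_singleton_mset [unfolded One_nat_def])
  then have "a 1 \<noteq> 0"
    using assms by (simp add: a_def w_def c_def)
  then have "finite {z. (\<Sum>s\<le>r. a s * z ^ s) = 0}"
    using assms by (subst polyfun_finite_roots) (auto intro!: exI [of _ 1])
  moreover have "infinite ((of_int :: int \<Rightarrow> complex) ` {m<..})"
    using infinite_Ioi [of m] by (simp add: finite_image_iff inj_on_def)
  ultimately have "\<not> (of_int ` {m<..} \<subseteq> {z. (\<Sum>s\<le>r. a s * z ^ s) = 0})"
    using finite_subset by blast
  then obtain i where i: "i > m" "(\<Sum>s\<le>r. a s * of_int i ^ s) \<noteq> 0"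
    by auto
  have coeff: "(\<Prod>n\<in>set_mset \<nu>. (of_int i / of_nat n) ^ count \<nu> n / fact (count \<nu> n))
      = w \<nu> * of_int i ^ size \<nu>" for \<nu>
    unfolding w_def size_multiset_overloaded_eq power_sum prod.distrib [symmetric]
    by (intro prod.cong) (auto simp: power_divide)
  have "(\<Sum>\<nu>\<in>parts r. sc (w \<nu> * of_int i ^ size \<nu>) (mon \<nu> m)) \<in> W k"
    using Em_mon_in_W [OF assms(1,2) i(1), of r] by (simp add: Em_mon coeff)
  moreover have "(\<Sum>\<nu>\<in>parts r. sc (w \<nu> * of_int i ^ size \<nu>) (mon \<nu> m - sc (c \<nu>) (mon {#r#} m))) \<in> W k"
    using c by (intro W_sum W_sc)
  ultimately have "(\<Sum>\<nu>\<in>parts r. sc (w \<nu> * of_int i ^ size \<nu>) (mon \<nu> m))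
      - (\<Sum>\<nu>\<in>parts r. sc (w \<nu> * of_int i ^ size \<nu>) (mon \<nu> m - sc (c \<nu>) (mon {#r#} m))) \<in> W k"
    by (rule W_diff)
  also have "(\<Sum>\<nu>\<in>parts r. sc (w \<nu> * of_int i ^ size \<nu>) (mon \<nu> m))
      - (\<Sum>\<nu>\<in>parts r. sc (w \<nu> * of_int i ^ size \<nu>) (mon \<nu> m - sc (c \<nu>) (mon {#r#} m)))
    = sc (\<Sum>\<nu>\<in>parts r. w \<nu> * c \<nu> * of_int i ^ size \<nu>) (mon {#r#} m)"
  proof -
    have "sc (\<Sum>\<nu>\<in>A. g \<nu>) f = (\<Sum>\<nu>\<in>A. sc (g \<nu>) f)" for A :: "nat multiset set" and g f
      by (induction A rule: infinite_finite_induct) (simp_all add: sc_add_left)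
    then show ?thesis
      by (simp add: sc_diff_right sum_subtractf mult_ac)
  qed
  also have "(\<Sum>\<nu>\<in>parts r. w \<nu> * c \<nu> * of_int i ^ size \<nu>) = (\<Sum>s\<le>r. a s * of_int i ^ s)"
  proof -
    have "(\<Sum>s\<le>r. a s * of_int i ^ s)
        = (\<Sum>s\<le>r. \<Sum>\<nu>\<in>{\<nu> \<in> parts r. size \<nu> = s}. w \<nu> * c \<nu> * of_int i ^ size \<nu>)"
      by (auto simp: a_def sum_distrib_right intro!: sum.cong)
    also have "\<dots> = (\<Sum>\<nu>\<in>parts r. w \<nu> * c \<nu> * of_int i ^ size \<nu>)"
      using size by (intro sum.group finite_parts) auto
    finally show ?thesis by simp
  qed
  finally show ?thesis
    using i(2) by (rule W_sc_cancel)
qed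

lemma mon_in_W:
  assumes "k > 0" "m > 0" "0 \<notin># \<nu>"
  shows "mon \<nu> m \<in> W k"
proof (cases "\<nu> = {#}")
  case True
  \<comment> \<open>Taking \<open>r = 0\<close> in \<open>Em_mon_in_W\<close> works because the
    constant term of the exponential is the identity.\<close>
  then show ?thesis
    using Em_mon_in_W [of k m "m + 1" 0] assms by (simp add: Em_deg_0)
next
  case False
  then obtain x \<mu> where "\<nu> = add_mset x \<mu>"
    by (metis multiset_cases)
  then have "sum_mset \<nu> > 0"
    using assms by auto
  then show ?thesis
    using R_subset_W [OF _ mon_in_R [of m \<nu> k]] mon_single_in_W [of k m "sum_mset \<nu>"] assms False
    by simp
qed

theorem theorem4p4:
  fixes k :: nat and m :: int
  assumes "k > 0" and "m > 0"
  shows "VLplus_m m \<subseteq> C2 k VLplus"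
proof
  fix f assume "f \<in> VLplus_m m"
  then obtain p q where p: "p \<in> M1plus" and q: "q \<in> M1minus"
    and f: "f = (tens p m + tens p (- m)) + (tens q m - tens q (- m))"
    by (auto simp: VLplus_m_def)
  \<comment> \<open>Being in the eigenspaces of \<open>theta\<close>, \<open>p\<close> is supported
    on multisets of even size and \<open>q\<close> on those of odd size, which gives the signs here
    and for \<open>q\<close>.\<close>
  have "theta (tens p m) = tens p (- m)"
  proof
    fix x :: "nat multiset \<times> int"
    have "theta p (fst x, 0) = p (fst x, 0)"
      using p by (simp add: M1plus_def)
    then have "(-1) ^ size (fst x) * p (fst x, 0) = p (fst x, 0)"
      by (simp add: theta_def)
    then show "theta (tens p m) x = tens p (- m) x"
      by (cases x) (auto simp: theta_def tens_def)
  qed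
  moreover have "theta (tens q m) = - tens q (- m)"
  proof
    fix x :: "nat multiset \<times> int"
    have "theta q (fst x, 0) = - q (fst x, 0)"
      using q by (simp add: M1minus_def)
    then have "(-1) ^ size (fst x) * q (fst x, 0) = - q (fst x, 0)"
      by (simp add: theta_def)
    then show "theta (tens q m) x = (- tens q (- m)) x"
      by (cases x) (auto simp: theta_def tens_def)
  qed
  \<comment> \<open>\<open>f\<close> is thus the symmetrisation of a vector of
    \<open>M(1) \<otimes> e^(m \<alpha>)\<close>, and it suffices to place that vector in
    \<open>W\<close>.\<close>
  ultimately have f': "f = (tens p m + tens q m) + theta (tens p m + tens q m)"
    by (simp add: f theta_add)
  have "tens g m \<in> W k" if "g \<in> VL" for g
  proof -
    define S where "S = {\<mu>. g (\<mu>, 0) \<noteq> 0}"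
    have "S \<subseteq> fst ` {x. g x \<noteq> 0}"
      by (force simp: S_def)
    with that have fin: "finite S"
      by (auto simp: VL_def intro: finite_subset)
    have "tens g m = (\<Sum>\<mu>\<in>S. sc (g (\<mu>, 0)) (mon \<mu> m))"
    proof
      fix x :: "nat multiset \<times> int"
      show "tens g m x = (\<Sum>\<mu>\<in>S. sc (g (\<mu>, 0)) (mon \<mu> m)) x"
      proof (cases x)
        case (Pair \<mu> i)
        have "(\<Sum>\<nu>\<in>S. g (\<nu>, 0) * (if \<mu> = \<nu> \<and> i = m then 1 else 0))
            = (\<Sum>\<nu>\<in>S. if \<mu> = \<nu> then (if i = m then g (\<nu>, 0) else 0) else 0)"
          by (intro sum.cong) auto
        then show ?thesis
          using fin by (auto simp: Pair tens_def sum_apply sc_def mon_apply S_def)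
      qed
    qed
    also have "\<dots> \<in> W k"
      using that assms by (intro W_sum W_sc mon_in_W) (auto simp: S_def VL_def)
    finally show ?thesis .
  qed
  with p q have "tens p m + tens q m \<in> W k"
    by (intro W_add) (auto simp: M1plus_def M1minus_def M1_def)
  then show "f \<in> C2 k VLplus"
    by (simp add: f' W_def)
qed

end
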